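(* Let $\mathcal{H}$ be either the Drury--Arveson space $H^2_d$ for $d\ge 2$ or the classical Dirichlet space. Then the inclusion $$\iota:\mathrm{Mult}(\mathcal{H})\hookrightarrow\mathrm{Mult}(\mathcal{H}\odot\mathcal{H})$$ does not have a completely bounded inverse.
   Context: For $d\in\mathbb{N}\cup\{\infty\}$, the Drury--Arveson space $H^2_d$ is the reproducing kernel Hilbert space on the open unit ball of $\mathbb{C}^d$ (of $\ell^2$ if $d=\infty$) with kernel $K(z,w)=\frac1{1-\langle z,w\rangle}$. The classical Dirichlet space is the space of analytic functions $f(z)=\sum_{n\ge0}a_nz^n$ on the open unit disc with $\|f\|^2=\sum_{n\ge0}(n+1)|a_n|^2<\infty$. Let $X$ denote the ball or disc on which $\mathcal{H}$ lives. Weak product: $\mathcal{H}\odot\mathcal{H} = \{ h = \sum_{i=1}^\infty f_i g_i : f_i,g_i\in\mathcal{H},\ \sum_{i=1}^\infty \|f_i\|\|g_i\| < \infty\}$, with norm $\|h\| = \inf\{\sum_i \|f_i\|\|g_i\| : h = \sum_i f_i g_i\}$; it is a Banach function space on $X$. For $\mathcal{B}=\mathcal{H}$ or $\mathcal{H}\odot\mathcal{H}$, $\mathrm{Mult}(\mathcal{B})$ is the set of $\varphi:X\to\mathbb{C}$ with $\varphi f\in\mathcal{B}$ for all $f\in\mathcal{B}$. One has $\mathrm{Mult}(\mathcal{H})\subset\mathrm{Mult}(\mathcal{H}\odot\mathcal{H})$; $\iota$ is this inclusion. Hankel operators: let $\overline{\mathcal{H}}=\{\overline f: f\in\mathcal{H}\}$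 be the space of pointwise complex conjugates, with $\langle \overline f,\overline g\rangle_{\overline{\mathcal{H}}}=\langle g,f\rangle_{\mathcal{H}}$. $\mathrm{HAN}(\mathcal{H})\subset B(\mathcal{H},\overline{\mathcal{H}})$ is the space of bounded operators $T$ for which there is a (necessarily unique) $L\in(\mathcal{H}\odot\mathcal{H})^*$ with $\langle Tf,\overline g\rangle_{\overline{\mathcal{H}}}=L(fg)$ for all $f,g\in\mathcal{H}$; write $[h,T]=L(h)$. Let $\mathrm{HAN}_0(\mathcal{H})$ be the subspace of compact operators in $\mathrm{HAN}(\mathcal{H})$; via $h\mapsto[h,\cdot]$ one has $\mathcal{H}\odot\mathcal{H}\cong\mathrm{HAN}_0(\mathcal{H})^*$ isometrically. Operator space structures: $\mathrm{Mult}(\mathcal{H})\subset B(\mathcal{H})$ via multiplication operators, so $M_n(\mathrm{Mult}(\mathcal{H}))$ is normed as a subspace of $B(\mathcal{H}^n)$. $\mathrm{HAN}_0(\mathcal{H})$ has the operator space structure inherited from $B(\mathcal{H},\overline{\mathcal{H}})$, and $\mathcal{H}\odot\mathcal{H}$ has the dual operator space structure: the norm of $[h_{ij}]\in M_m(\mathcal{H}\odot\mathcal{H})$ is the completely bounded norm of $\mathrm{HAN}_0(\mathcal{H})\to M_m(\mathbb{C})$, $T\mapsto[[h_{ij},T]]_{i,j}$. Every multiplier of $\mathcal{H}\odot\mathcal{H}$ is completely bounded on $\mathcal{H}\odot\mathcal{H}$, and the norm of $[\theta_{ij}]\in M_n(\mathrm{Mult}(\mathcal{H}\odot\mathcal{H}))$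 is the completely bounded norm of $\mathcal{H}\odot\mathcal{H}\to M_n(\mathcal{H}\odot\mathcal{H})$, $h\mapsto[\theta_{ij}h]$. The conclusion means: there is no completely bounded linear map $\mathrm{Mult}(\mathcal{H}\odot\mathcal{H})\to\mathrm{Mult}(\mathcal{H})$ that is a two-sided inverse of $\iota$. *)

theory Defs
  imports "HOL-Analysis.Analysis"
begin

section \<open>Hilbert spaces of functions\<close>

text \<open>A function \<open>X \<rightarrow> \<complex>\<close> on a subset \<open>X\<close> of a type is represented by its
  extension by zero, so that equality of functions is equality on \<open>X\<close>.\<close>

definition vanishes_off :: "'x set \<Rightarrow> ('x \<Rightarrow> complex) \<Rightarrow> bool" where
  "vanishes_off X f \<longleftrightarrow> (\<forall>x. x \<notin> X \<longrightarrow> f x = 0)"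

definition fun_subspace :: "('x \<Rightarrow> complex) set \<Rightarrow> bool" where
  "fun_subspace V \<longleftrightarrow>
     (\<lambda>x. 0) \<in> V \<and>
     (\<forall>f\<in>V. \<forall>g\<in>V. (\<lambda>x. f x + g x) \<in> V) \<and>
     (\<forall>c. \<forall>f\<in>V. (\<lambda>x. c * f x) \<in> V)"

definition linear_map_on ::
  "('x \<Rightarrow> complex) set \<Rightarrow> (('x \<Rightarrow> complex) \<Rightarrow> ('y \<Rightarrow> complex)) \<Rightarrow> bool" where
  "linear_map_on V T \<longleftrightarrow>
     (\<forall>f\<in>V. \<forall>g\<in>V. T (\<lambda>x. f x + g x) = (\<lambda>y. T f y + T g y)) \<and>
     (\<forall>c. \<forall>f\<in>V. T (\<lambda>x. c * f x) = (\<lambda>y. c * T f y))"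

definition linear_functional_on ::
  "('x \<Rightarrow> complex) set \<Rightarrow> (('x \<Rightarrow> complex) \<Rightarrow> complex) \<Rightarrow> bool" where
  "linear_functional_on V L \<longleftrightarrow>
     (\<forall>f\<in>V. \<forall>g\<in>V. L (\<lambda>x. f x + g x) = L f + L g) \<and>
     (\<forall>c. \<forall>f\<in>V. L (\<lambda>x. c * f x) = c * L f)"

text \<open>The inner product \<open>ip\<close> is linear in its first argument; only its values on \<open>carr\<close>
  are meaningful.\<close>

record 'x fspace =
  pts :: "'x set"
  carr :: "('x \<Rightarrow> complex) set"
  ip :: "('x \<Rightarrow> complex) \<Rightarrow> ('x \<Rightarrow> complex) \<Rightarrow> complex"

definition hnorm :: "'x fspace \<Rightarrow> ('x \<Rightarrow> complex) \<Rightarrow> real" where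
  "hnorm H f = sqrt (Re (ip H f f))"

definition hilbert_fspace :: "'x fspace \<Rightarrow> bool" where
  "hilbert_fspace H \<longleftrightarrow>
     fun_subspace (carr H) \<and>
     (\<forall>f\<in>carr H. vanishes_off (pts H) f) \<and>
     (\<forall>g\<in>carr H. linear_functional_on (carr H) (\<lambda>f. ip H f g)) \<and>
     (\<forall>f\<in>carr H. \<forall>g\<in>carr H. ip H g f = cnj (ip H f g)) \<and>
     (\<forall>f\<in>carr H. 0 \<le> Re (ip H f f)) \<and>
     (\<forall>f\<in>carr H. ip H f f = 0 \<longrightarrow> f = (\<lambda>x. 0)) \<and>
     (\<forall>F :: nat \<Rightarrow> 'x \<Rightarrow> complex.
        (\<forall>n. F n \<in> carr H) \<and>
        (\<forall>e>0. \<exists>N. \<forall>m\<ge>N. \<forall>n\<ge>N. hnorm H (\<lambda>x. F m x - F n x) < e) \<longrightarrow>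
        (\<exists>f\<in>carr H. (\<lambda>n. hnorm H (\<lambda>x. F n x - f x)) \<longlonglongrightarrow> 0))"

definition rkhs_with_kernel :: "'x set \<Rightarrow> ('x \<Rightarrow> 'x \<Rightarrow> complex) \<Rightarrow> 'x fspace \<Rightarrow> bool" where
  "rkhs_with_kernel X K H \<longleftrightarrow>
     hilbert_fspace H \<and> pts H = X \<and>
     (\<forall>w\<in>X. (\<lambda>z. if z \<in> X then K z w else 0) \<in> carr H \<and>
        (\<forall>f\<in>carr H. ip H f (\<lambda>z. if z \<in> X then K z w else 0) = f w))"

section \<open>The Drury--Arveson and Dirichlet spaces\<close>

text \<open>Points of \<open>\<complex>\<^sup>d\<close> (of \<open>\<ell>\<^sup>2\<close> if \<open>d = \<infinity>\<close>) are sequences supported on the indices \<open>i < d\<close>.\<close>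

definition unit_ball :: "enat \<Rightarrow> (nat \<Rightarrow> complex) set" where
  "unit_ball d = {z. (\<forall>i. d \<le> enat i \<longrightarrow> z i = 0) \<and>
                     summable (\<lambda>i. (cmod (z i))\<^sup>2) \<and> (\<Sum>i. (cmod (z i))\<^sup>2) < 1}"

definition drury_arveson_kernel :: "(nat \<Rightarrow> complex) \<Rightarrow> (nat \<Rightarrow> complex) \<Rightarrow> complex" where
  "drury_arveson_kernel z w = 1 / (1 - (\<Sum>i. z i * cnj (w i)))"

text \<open>A reproducing kernel Hilbert space is determined by its kernel, up to the irrelevant
  values of \<open>ip\<close> outside \<open>carr\<close>; hence a predicate.\<close>

definition drury_arveson_space :: "enat \<Rightarrow> (nat \<Rightarrow> complex) fspace \<Rightarrow> bool" where
  "drury_arveson_space d H \<longleftrightarrow> rkhs_with_kernel (unit_ball d) drury_arveson_kernel H"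

definition taylor_coeff :: "(complex \<Rightarrow> complex) \<Rightarrow> nat \<Rightarrow> complex" where
  "taylor_coeff f n = (deriv ^^ n) f 0 / fact n"

definition dirichlet_space :: "complex fspace" where
  "dirichlet_space =
     \<lparr> pts = ball 0 1,
       carr = {f. vanishes_off (ball 0 1) f \<and> f holomorphic_on ball 0 1 \<and>
                  summable (\<lambda>n. (real n + 1) * (cmod (taylor_coeff f n))\<^sup>2)},
       ip = (\<lambda>f g. \<Sum>n. (of_nat n + 1) * taylor_coeff f n * cnj (taylor_coeff g n)) \<rparr>"

section \<open>Weak products and multipliers\<close>

definition weak_factorization ::
  "'x fspace \<Rightarrow> ('x \<Rightarrow> complex) \<Rightarrow> (nat \<Rightarrow> 'x \<Rightarrow> complex) \<Rightarrow> (nat \<Rightarrow> 'x \<Rightarrow> complex) \<Rightarrow> bool" where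
  "weak_factorization H h f g \<longleftrightarrow>
     (\<forall>i. f i \<in> carr H \<and> g i \<in> carr H) \<and>
     summable (\<lambda>i. hnorm H (f i) * hnorm H (g i)) \<and>
     (\<forall>x. (\<lambda>i. f i x * g i x) sums h x)"

definition weak_product :: "'x fspace \<Rightarrow> ('x \<Rightarrow> complex) set" where
  "weak_product H = {h. \<exists>f g. weak_factorization H h f g}"

definition weak_product_norm :: "'x fspace \<Rightarrow> ('x \<Rightarrow> complex) \<Rightarrow> real" where
  "weak_product_norm H h =
     Inf {\<Sum>i. hnorm H (f i) * hnorm H (g i) | f g. weak_factorization H h f g}"

definition multipliers :: "'x set \<Rightarrow> ('x \<Rightarrow> complex) set \<Rightarrow> ('x \<Rightarrow> complex) set" where
  "multipliers X B = {\<phi>. vanishes_off X \<phi> \<and> (\<forall>f\<in>B. (\<lambda>x. \<phi> x * f x) \<in> B)}"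

section \<open>Hankel operators\<close>

definition cnj_fun :: "('x \<Rightarrow> complex) \<Rightarrow> ('x \<Rightarrow> complex)" where
  "cnj_fun f = (\<lambda>x. cnj (f x))"

definition conj_space :: "'x fspace \<Rightarrow> 'x fspace" where
  "conj_space H =
     \<lparr> pts = pts H, carr = cnj_fun ` carr H,
       ip = (\<lambda>F G. ip H (cnj_fun G) (cnj_fun F)) \<rparr>"

text \<open>Operators and functionals are set to zero outside their domain, so that they are
  determined by their values on the domain.\<close>

definition bounded_ops ::
  "'x fspace \<Rightarrow> 'x fspace \<Rightarrow> (('x \<Rightarrow> complex) \<Rightarrow> ('x \<Rightarrow> complex)) set" where
  "bounded_ops H K =
     {T. (\<forall>f\<in>carr H. T f \<in> carr K) \<and> linear_map_on (carr H) T \<and>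
         (\<exists>C. \<forall>f\<in>carr H. hnorm K (T f) \<le> C * hnorm H f) \<and>
         (\<forall>f. f \<notin> carr H \<longrightarrow> T f = (\<lambda>x. 0))}"

definition compact_op ::
  "'x fspace \<Rightarrow> 'x fspace \<Rightarrow> (('x \<Rightarrow> complex) \<Rightarrow> ('x \<Rightarrow> complex)) \<Rightarrow> bool" where
  "compact_op H K T \<longleftrightarrow>
     (\<forall>F :: nat \<Rightarrow> 'x \<Rightarrow> complex. (\<forall>n. F n \<in> carr H \<and> hnorm H (F n) \<le> 1) \<longrightarrow>
        (\<exists>r g. strict_mono r \<and> g \<in> carr K \<and>
           (\<lambda>n. hnorm K (\<lambda>x. T (F (r n)) x - g x)) \<longlonglongrightarrow> 0))"

definition weak_product_dual :: "'x fspace \<Rightarrow> (('x \<Rightarrow> complex) \<Rightarrow> complex) set" where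
  "weak_product_dual H =
     {L. linear_functional_on (weak_product H) L \<and>
         (\<exists>C. \<forall>h\<in>weak_product H. cmod (L h) \<le> C * weak_product_norm H h) \<and>
         (\<forall>h. h \<notin> weak_product H \<longrightarrow> L h = 0)}"

definition hankel_functional_of ::
  "'x fspace \<Rightarrow> (('x \<Rightarrow> complex) \<Rightarrow> ('x \<Rightarrow> complex)) \<Rightarrow> (('x \<Rightarrow> complex) \<Rightarrow> complex) \<Rightarrow> bool" where
  "hankel_functional_of H T L \<longleftrightarrow>
     L \<in> weak_product_dual H \<and>
     (\<forall>f\<in>carr H. \<forall>g\<in>carr H. ip (conj_space H) (T f) (cnj_fun g) = L (\<lambda>x. f x * g x))"

definition HAN :: "'x fspace \<Rightarrow> (('x \<Rightarrow> complex) \<Rightarrow> ('x \<Rightarrow> complex)) set" where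
  "HAN H = {T \<in> bounded_ops H (conj_space H). \<exists>L. hankel_functional_of H T L}"

definition HAN0 :: "'x fspace \<Rightarrow> (('x \<Rightarrow> complex) \<Rightarrow> ('x \<Rightarrow> complex)) set" where
  "HAN0 H = {T \<in> HAN H. compact_op H (conj_space H) T}"

definition hankel_pairing ::
  "'x fspace \<Rightarrow> ('x \<Rightarrow> complex) \<Rightarrow> (('x \<Rightarrow> complex) \<Rightarrow> ('x \<Rightarrow> complex)) \<Rightarrow> complex" where
  "hankel_pairing H h T = (THE L. hankel_functional_of H T L) h"

section \<open>Operator space structures\<close>

text \<open>In an \<open>n \<times> n\<close> matrix \<open>A :: nat \<Rightarrow> nat \<Rightarrow> 'v\<close> only the entries \<open>A i j\<close> with
  \<open>i, j < n\<close> are relevant. Matrix norms take values in \<open>ennreal\<close>, so that every supremum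
  is meaningful.\<close>

record 'v op_space =
  os_carrier :: "'v set"
  os_norm :: "nat \<Rightarrow> (nat \<Rightarrow> nat \<Rightarrow> 'v) \<Rightarrow> ennreal"

text \<open>The completely bounded norm of \<open>\<Phi> : V \<rightarrow> M\<^sub>n(W)\<close>, where \<open>M\<^sub>k(M\<^sub>n(W))\<close> is
  identified with \<open>M\<^bsub>kn\<^esub>(W)\<close>: the index \<open>p < k n\<close> stands for the pair \<open>(p div n, p mod n)\<close>.\<close>

definition cb_norm ::
  "'v op_space \<Rightarrow> 'w op_space \<Rightarrow> nat \<Rightarrow> ('v \<Rightarrow> nat \<Rightarrow> nat \<Rightarrow> 'w) \<Rightarrow> ennreal" where
  "cb_norm V W n \<Phi> =
     Sup {os_norm W (k * n) (\<lambda>p q. \<Phi> (A (p div n) (q div n)) (p mod n) (q mod n)) | k A.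
            0 < k \<and> (\<forall>i<k. \<forall>j<k. A i j \<in> os_carrier V) \<and> os_norm V k A \<le> 1}"

definition completely_bounded :: "'v op_space \<Rightarrow> 'w op_space \<Rightarrow> ('v \<Rightarrow> 'w) \<Rightarrow> bool" where
  "completely_bounded V W R \<longleftrightarrow> cb_norm V W 1 (\<lambda>v i j. R v) < \<infinity>"

text \<open>The norm of \<open>[T i j]\<close> as an operator \<open>H\<^sup>n \<rightarrow> K\<^sup>n\<close>.\<close>

definition op_matrix_norm ::
  "'x fspace \<Rightarrow> 'x fspace \<Rightarrow> nat \<Rightarrow>
   (nat \<Rightarrow> nat \<Rightarrow> ('x \<Rightarrow> complex) \<Rightarrow> ('x \<Rightarrow> complex)) \<Rightarrow> ennreal" where
  "op_matrix_norm H K n T =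
     Sup {ennreal (sqrt (\<Sum>i<n. (hnorm K (\<lambda>x. \<Sum>j<n. T i j (f j) x))\<^sup>2)) | f.
            (\<forall>j<n. f j \<in> carr H) \<and> (\<Sum>j<n. (hnorm H (f j))\<^sup>2) \<le> 1}"

definition complex_matrix_norm :: "nat \<Rightarrow> (nat \<Rightarrow> nat \<Rightarrow> complex) \<Rightarrow> ennreal" where
  "complex_matrix_norm n a =
     Sup {ennreal (sqrt (\<Sum>i<n. (cmod (\<Sum>j<n. a i j * v j))\<^sup>2)) | v.
            (\<Sum>j<n. (cmod (v j))\<^sup>2) \<le> 1}"

definition complex_os :: "complex op_space" where
  "complex_os = \<lparr> os_carrier = UNIV, os_norm = complex_matrix_norm \<rparr>"

definition HAN0_os :: "'x fspace \<Rightarrow> (('x \<Rightarrow> complex) \<Rightarrow> ('x \<Rightarrow> complex)) op_space" where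
  "HAN0_os H = \<lparr> os_carrier = HAN0 H, os_norm = op_matrix_norm H (conj_space H) \<rparr>"

definition weak_product_os :: "'x fspace \<Rightarrow> ('x \<Rightarrow> complex) op_space" where
  "weak_product_os H =
     \<lparr> os_carrier = weak_product H,
       os_norm = (\<lambda>m h. cb_norm (HAN0_os H) complex_os m (\<lambda>T i j. hankel_pairing H (h i j) T)) \<rparr>"

definition mult_os :: "'x fspace \<Rightarrow> ('x \<Rightarrow> complex) op_space" where
  "mult_os H =
     \<lparr> os_carrier = multipliers (pts H) (carr H),
       os_norm = (\<lambda>n \<phi>. op_matrix_norm H H n (\<lambda>i j f x. \<phi> i j x * f x)) \<rparr>"

definition mult_weak_product_os :: "'x fspace \<Rightarrow> ('x \<Rightarrow> complex) op_space" where
  "mult_weak_product_os H =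
     \<lparr> os_carrier = multipliers (pts H) (weak_product H),
       os_norm = (\<lambda>n \<theta>. cb_norm (weak_product_os H) (weak_product_os H) n
                           (\<lambda>h i j x. \<theta> i j x * h x)) \<rparr>"

definition mult_inclusion :: "('x \<Rightarrow> complex) \<Rightarrow> ('x \<Rightarrow> complex)" where
  "mult_inclusion \<phi> = \<phi>"

definition has_cb_inverse ::
  "('x \<Rightarrow> complex) op_space \<Rightarrow> ('x \<Rightarrow> complex) op_space \<Rightarrow>
   (('x \<Rightarrow> complex) \<Rightarrow> ('x \<Rightarrow> complex)) \<Rightarrow> bool" where
  "has_cb_inverse V W J \<longleftrightarrow>
     (\<exists>R. (\<forall>w\<in>os_carrier W. R w \<in> os_carrier V) \<and>
          linear_map_on (os_carrier W) R \<and>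
          (\<forall>v\<in>os_carrier V. R (J v) = v) \<and>
          (\<forall>w\<in>os_carrier W. J (R w) = w) \<and>
          completely_bounded W V R)"

end

theory Submission
  imports Defs "HOL-Complex_Analysis.Complex_Analysis"
begin

text \<open>Hankel operators satisfy \<open>\<langle>T (\<psi> f), cnj g\<rangle> = \<langle>T f, cnj (\<psi> g)\<rangle>\<close>, so a multiplier acting on the right of
  \<open>T\<close> is an adjoint multiplier acting on its left. Hence the norm of a matrix over
  \<open>Mult(H \<odot> H)\<close> is at most the norm of its transpose over \<open>Mult(H)\<close>: columns of multipliers are
  dominated by the corresponding rows. If \<open>\<iota>\<close> had a completely bounded inverse, columns would be
  bounded by a multiple of rows in \<open>Mult(H)\<close>. This fails: in the Drury--Arveson space the row
  with entries \<open>z\<^sub>0 z\<^sub>1\<^sup>j\<close> is a contraction while \<open>\<Sum>\<^sub>j \<parallel>z\<^sub>0 z\<^sub>1\<^sup>j\<parallel>\<^sup>2\<close> diverges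
  like the harmonic series; in the Dirichlet space the row with entries \<open>z\<^sup>n / sqrt (n + 1)\<close>,
  \<open>n < k\<close>, has norm squared at most \<open>2 harm k\<close>, while its transpose maps \<open>1\<close> to a vector of norm
  squared \<open>k\<close>.\<close>

section \<open>Semi-inner products on function spaces\<close>

text \<open>The transpose has one source: the matrix of entrywise adjoints
  \<open>[M_(a_ij)^*]\<close> is the adjoint of \<open>[M_(a_ji)]\<close>, not of
  \<open>[M_(a_ij)]\<close>. The resulting bound for matrices over \<open>HAN0\<close> passes
  unchanged through two dualities, to the weak product and then to its multipliers. No adjoint is
  ever constructed: the estimate is a Cauchy-Schwarz argument on vectors. The two spaces pose
  opposite difficulties. The Drury-Arveson space is known only through its kernel, so that
  coordinates multiply at all, that rows contract, and how large monomials are must be extracted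
  from finite kernel combinations and point evaluations, with a Riesz argument supplying membership.
  The Dirichlet space is given by coefficients; there the weights \<open>1 / sqrt (n + 1)\<close>
  normalise \<open>z^n\<close>, while a degreewise Cauchy-Schwarz leaves a harmonic sum for the row.
  The locale keeps what both descriptions provide directly: a semi-inner product on a space of
  functions.\<close>

locale semi_inner_fspace =
  fixes H :: "'x fspace"
  assumes fun_subspace_carr: "fun_subspace (carr H)"
    and ip_linear: "g \<in> carr H \<Longrightarrow> linear_functional_on (carr H) (\<lambda>f. ip H f g)"
    and ip_cnj: "f \<in> carr H \<Longrightarrow> g \<in> carr H \<Longrightarrow> ip H g f = cnj (ip H f g)"
    and ip_nonneg: "f \<in> carr H \<Longrightarrow> 0 \<le> Re (ip H f f)"
begin

lemma zero_mem: "(\<lambda>x. 0) \<in> carr H"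
  and add_mem: "f \<in> carr H \<Longrightarrow> g \<in> carr H \<Longrightarrow> (\<lambda>x. f x + g x) \<in> carr H"
  and scale_mem: "f \<in> carr H \<Longrightarrow> (\<lambda>x. c * f x) \<in> carr H"
  using fun_subspace_carr unfolding fun_subspace_def by auto

lemma sum_mem:
  assumes "\<And>i. i \<in> I \<Longrightarrow> f i \<in> carr H"
  shows "(\<lambda>x. \<Sum>i\<in>I. f i x) \<in> carr H"
  using assms by (induction I rule: infinite_finite_induct) (auto intro: zero_mem add_mem)

lemma diff_mem: "f \<in> carr H \<Longrightarrow> g \<in> carr H \<Longrightarrow> (\<lambda>x. f x - g x) \<in> carr H"
  using add_mem[of f "\<lambda>x. -1 * g x"] scale_mem[of g "-1"] by simp

lemma ip_add_left:
  "f \<in> carr H \<Longrightarrow> g \<in> carr H \<Longrightarrow> h \<in> carr H \<Longrightarrow> ip H (\<lambda>x. f x + g x) h = ip H f h + ip H g h"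
  and ip_scale_left: "f \<in> carr H \<Longrightarrow> h \<in> carr H \<Longrightarrow> ip H (\<lambda>x. c * f x) h = c * ip H f h"
  using ip_linear[of h] unfolding linear_functional_on_def by auto

lemma ip_zero_left: "h \<in> carr H \<Longrightarrow> ip H (\<lambda>x. 0) h = 0"
  using ip_scale_left[OF zero_mem, of h 0] by simp

lemma ip_add_right:
  assumes "f \<in> carr H" "g \<in> carr H" "h \<in> carr H"
  shows "ip H h (\<lambda>x. f x + g x) = ip H h f + ip H h g"
  using ip_cnj[OF add_mem[OF assms(1,2)] assms(3)] ip_cnj[of f h] ip_cnj[of g h] assms
  by (simp add: ip_add_left)

lemma ip_scale_right:
  assumes "f \<in> carr H" "h \<in> carr H"
  shows "ip H h (\<lambda>x. c * f x) = cnj c * ip H h f"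
  using ip_cnj[OF scale_mem[OF assms(1)] assms(2)] ip_cnj[of f h] assms
  by (simp add: ip_scale_left)

lemma ip_zero_right: "h \<in> carr H \<Longrightarrow> ip H h (\<lambda>x. 0) = 0"
  using ip_scale_right[OF zero_mem, of h 0] by simp

lemma ip_sum_left:
  assumes "\<And>i. i \<in> I \<Longrightarrow> f i \<in> carr H" "h \<in> carr H"
  shows "ip H (\<lambda>x. \<Sum>i\<in>I. f i x) h = (\<Sum>i\<in>I. ip H (f i) h)"
  using assms
  by (induction I rule: infinite_finite_induct) (auto simp: ip_zero_left ip_add_left sum_mem)

lemma ip_sum_right:
  assumes "\<And>i. i \<in> I \<Longrightarrow> f i \<in> carr H" "h \<in> carr H"
  shows "ip H h (\<lambda>x. \<Sum>i\<in>I. f i x) = (\<Sum>i\<in>I. ip H h (f i))"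
  using assms
  by (induction I rule: infinite_finite_induct) (auto simp: ip_zero_right ip_add_right sum_mem)

lemma ip_diff_left:
  assumes "f \<in> carr H" "g \<in> carr H" "h \<in> carr H"
  shows "ip H (\<lambda>x. f x - g x) h = ip H f h - ip H g h"
  using ip_add_left[of f "\<lambda>x. -1 * g x" h] ip_scale_left[of g h "-1"] scale_mem[of g "-1"] assms
  by simp

lemma ip_diff_right:
  assumes "f \<in> carr H" "g \<in> carr H" "h \<in> carr H"
  shows "ip H h (\<lambda>x. f x - g x) = ip H h f - ip H h g"
  using ip_add_right[of f "\<lambda>x. -1 * g x" h] ip_scale_right[of g h "-1"] scale_mem[of g "-1"] assms
  by simp

lemma hnorm_nonneg: "f \<in> carr H \<Longrightarrow> 0 \<le> hnorm H f"
  by (simp add: hnorm_def ip_nonneg)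

lemma hnorm_sq: "f \<in> carr H \<Longrightarrow> (hnorm H f)\<^sup>2 = Re (ip H f f)"
  by (simp add: hnorm_def ip_nonneg)

lemma ip_self: "f \<in> carr H \<Longrightarrow> ip H f f = complex_of_real ((hnorm H f)\<^sup>2)"
  using ip_cnj[of f f] hnorm_sq[of f] by (auto simp: complex_eq_iff)

lemma hnorm_zero: "hnorm H (\<lambda>x. 0) = 0"
  by (simp add: hnorm_def ip_zero_left zero_mem)

lemma hnorm_scale: "f \<in> carr H \<Longrightarrow> hnorm H (\<lambda>x. c * f x) = cmod c * hnorm H f"
proof -
  assume f: "f \<in> carr H"
  have "(hnorm H (\<lambda>x. c * f x))\<^sup>2 = Re (c * cnj c * ip H f f)"
    using f by (simp add: hnorm_sq scale_mem ip_scale_left ip_scale_right mult.assoc)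
  also have "\<dots> = (cmod c * hnorm H f)\<^sup>2"
    using f by (simp only: ip_self complex_norm_square[symmetric] of_real_mult[symmetric] Re_complex_of_real
      power_mult_distrib)
  finally show ?thesis
    using f by (simp add: hnorm_nonneg scale_mem)
qed

lemma hnorm_sq_diff:
  assumes "f \<in> carr H" "g \<in> carr H"
  shows "(hnorm H (\<lambda>x. f x - g x))\<^sup>2 = (hnorm H f)\<^sup>2 - 2 * Re (ip H f g) + (hnorm H g)\<^sup>2"
  using assms arg_cong[OF ip_cnj[of f g], of Re]
  by (simp add: hnorm_sq diff_mem ip_diff_left ip_diff_right)

lemma hnorm_sq_add:
  assumes "f \<in> carr H" "g \<in> carr H"
  shows "(hnorm H (\<lambda>x. f x + g x))\<^sup>2 = (hnorm H f)\<^sup>2 + 2 * Re (ip H f g) + (hnorm H g)\<^sup>2"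
  using assms arg_cong[OF ip_cnj[of f g], of Re]
  by (simp add: hnorm_sq add_mem ip_add_left ip_add_right)

text \<open>The form is only semidefinite, so a norm may vanish on a nonzero vector. If one of the
  norms is nonzero, the classical minimising multiple works. If both vanish, the expansion with
  \<open>t = ip H f g\<close> reads \<open>0 <= - 2 |t|^2\<close>.\<close>

lemma Cauchy_Schwarz:
  assumes f: "f \<in> carr H" and g: "g \<in> carr H"
  shows "cmod (ip H f g) \<le> hnorm H f * hnorm H g"
proof -
  have expand: "0 \<le> (hnorm H u)\<^sup>2 - 2 * Re (cnj t * ip H u v) + (cmod t * hnorm H v)\<^sup>2"
    if "u \<in> carr H" "v \<in> carr H" for u v t
    using hnorm_sq_diff[of u "\<lambda>x. t * v x"] that
    by (simp add: hnorm_scale scale_mem ip_scale_right) (metis zero_le_power2)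
  have main: "cmod (ip H u v) \<le> hnorm H u * hnorm H v"
    if u: "u \<in> carr H" and v: "v \<in> carr H" and pos: "hnorm H v \<noteq> 0" for u v
  proof -
    define n where "n = hnorm H v"
    define c where "c = ip H u v"
    define t where "t = c / of_real (n\<^sup>2)"
    have "n > 0"
      using pos hnorm_nonneg[OF v] by (simp add: n_def)
    have "cnj t * c = complex_of_real ((cmod c)\<^sup>2 / n\<^sup>2)"
      unfolding t_def by (simp add: complex_norm_square mult.commute flip: of_real_power)
    moreover have "(cmod t * n)\<^sup>2 = (cmod c)\<^sup>2 / n\<^sup>2"
      unfolding t_def using \<open>n > 0\<close>
      by (simp add: norm_divide norm_mult power2_eq_square)
    ultimately have "0 \<le> (hnorm H u)\<^sup>2 - (cmod c)\<^sup>2 / n\<^sup>2"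
      using expand[OF u v, of t] unfolding n_def[symmetric] c_def[symmetric] by simp
    then have "(cmod (ip H u v))\<^sup>2 \<le> (hnorm H u * hnorm H v)\<^sup>2"
      using \<open>n > 0\<close> unfolding n_def[symmetric] c_def[symmetric]
      by (simp add: pos_divide_le_eq power_mult_distrib)
    then show ?thesis
      by (rule power2_le_imp_le) (use u v in \<open>auto simp: hnorm_nonneg\<close>)
  qed
  consider "hnorm H g \<noteq> 0" | "hnorm H f \<noteq> 0" | "hnorm H f = 0" "hnorm H g = 0" by blast
  then show ?thesis
  proof cases
    case 1
    then show ?thesis using main f g by blast
  next
    case 2
    then show ?thesis
      using main[OF g f] ip_cnj[OF f g] by (simp add: mult.commute)
  next
    case 3
    have "cnj (ip H f g) * ip H f g = complex_of_real ((cmod (ip H f g))\<^sup>2)"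
      using complex_norm_square[of "ip H f g"] by (simp add: mult.commute)
    then show ?thesis
      using expand[OF f g, of "ip H f g"] 3 by simp
  qed
qed

text \<open>Cauchy-Schwarz in a direct sum of copies of \<open>H\<close>, without forming that
  space.\<close>

lemma Cauchy_Schwarz_sum:
  assumes "\<And>i. i \<in> I \<Longrightarrow> f i \<in> carr H" "\<And>i. i \<in> I \<Longrightarrow> g i \<in> carr H"
  shows "cmod (\<Sum>i\<in>I. ip H (f i) (g i))
           \<le> sqrt (\<Sum>i\<in>I. (hnorm H (f i))\<^sup>2) * sqrt (\<Sum>i\<in>I. (hnorm H (g i))\<^sup>2)"
proof -
  have "cmod (\<Sum>i\<in>I. ip H (f i) (g i)) \<le> (\<Sum>i\<in>I. hnorm H (f i) * hnorm H (g i))"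
    by (rule sum_norm_le) (use assms Cauchy_Schwarz in auto)
  also have "\<dots> = (\<Sum>i\<in>I. \<bar>hnorm H (f i)\<bar> * \<bar>hnorm H (g i)\<bar>)"
    using assms by (intro sum.cong) (auto simp: hnorm_nonneg)
  also have "\<dots> \<le> L2_set (\<lambda>i. hnorm H (f i)) I * L2_set (\<lambda>i. hnorm H (g i)) I"
    by (rule L2_set_mult_ineq)
  finally show ?thesis by (simp add: L2_set_def)
qed

lemma hnorm_triangle:
  assumes f: "f \<in> carr H" and g: "g \<in> carr H"
  shows "hnorm H (\<lambda>x. f x + g x) \<le> hnorm H f + hnorm H g"
proof -
  have "Re (ip H f g) \<le> hnorm H f * hnorm H g"
    using Cauchy_Schwarz[OF f g] complex_Re_le_cmod order_trans by blast
  then have "(hnorm H (\<lambda>x. f x + g x))\<^sup>2 \<le> (hnorm H f + hnorm H g)\<^sup>2"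
    using hnorm_sq_add[OF f g] by (simp add: power2_sum)
  then show ?thesis
    by (rule power2_le_imp_le) (use f g in \<open>auto simp: hnorm_nonneg\<close>)
qed

end

section \<open>Contractive multipliers and Hankel operators\<close>

definition contractive_multiplier :: "'x fspace \<Rightarrow> ('x \<Rightarrow> complex) \<Rightarrow> bool" where
  "contractive_multiplier H \<psi> \<longleftrightarrow>
     (\<forall>f\<in>carr H. (\<lambda>x. \<psi> x * f x) \<in> carr H \<and> hnorm H (\<lambda>x. \<psi> x * f x) \<le> hnorm H f)"

text \<open>The value zero off \<open>carr H\<close> is forced by \<open>bounded_ops\<close>, whose
  members vanish outside their domain.\<close>

definition mult_right ::
  "'x fspace \<Rightarrow> (('x \<Rightarrow> complex) \<Rightarrow> ('x \<Rightarrow> complex)) \<Rightarrow> ('x \<Rightarrow> complex) \<Rightarrow>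
   (('x \<Rightarrow> complex) \<Rightarrow> ('x \<Rightarrow> complex))" where
  "mult_right H T \<psi> = (\<lambda>f. if f \<in> carr H then T (\<lambda>x. \<psi> x * f x) else (\<lambda>x. 0))"

lemma cnj_fun_cnj_fun [simp]: "cnj_fun (cnj_fun f) = f"
  by (simp add: cnj_fun_def)

lemma carr_conj_space_iff: "F \<in> carr (conj_space H) \<longleftrightarrow> cnj_fun F \<in> carr H"
proof
  assume "cnj_fun F \<in> carr H"
  then have "cnj_fun (cnj_fun F) \<in> cnj_fun ` carr H" by (rule imageI)
  then show "F \<in> carr (conj_space H)" by (simp add: conj_space_def)
qed (auto simp: conj_space_def)

lemma hnorm_conj_space: "hnorm (conj_space H) F = hnorm H (cnj_fun F)"
  by (simp add: hnorm_def conj_space_def)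

lemma ip_conj_space: "ip (conj_space H) F (cnj_fun g) = ip H g (cnj_fun F)"
  by (simp add: conj_space_def)

section \<open>Weak factorizations and bounded functionals on the weak product\<close>

context semi_inner_fspace
begin

lemma weak_factorization_tail:
  assumes "weak_factorization H h f g"
  shows "weak_factorization H (\<lambda>x. h x - (\<Sum>i<n. f i x * g i x)) (\<lambda>i. f (i + n)) (\<lambda>i. g (i + n))"
  using assms unfolding weak_factorization_def
  by (auto intro: summable_ignore_initial_segment sums_split_initial_segment)

lemma product_mem_weak_product:
  assumes "f \<in> carr H" "g \<in> carr H"
  shows "(\<lambda>x. f x * g x) \<in> weak_product H"
proof -
  have "weak_factorization H (\<lambda>x. f x * g x)
          (\<lambda>i. if i = (0::nat) then f else (\<lambda>x. 0)) (\<lambda>i. if i = 0 then g else (\<lambda>x. 0))"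
    unfolding weak_factorization_def
  proof (intro conjI allI)
    show "summable (\<lambda>i. hnorm H (if i = (0::nat) then f else (\<lambda>x. 0)) * hnorm H (if i = 0 then g else (\<lambda>x. 0)))"
      by (rule summable_finite[of "{0}"]) (auto simp: hnorm_zero)
    show "(\<lambda>i. (if i = (0::nat) then f else (\<lambda>x. 0)) x * (if i = 0 then g else (\<lambda>x. 0)) x) sums (f x * g x)" for x
      using sums_single[of 0 "\<lambda>i. f x * g x"]
      by (rule back_subst[where P = "\<lambda>s. s sums (f x * g x)"]) auto
  qed (use assms zero_mem in auto)
  then show ?thesis by (auto simp: weak_product_def)
qed

lemma weak_factorization_suminf_nonneg:
  assumes "weak_factorization H h f g"
  shows "0 \<le> (\<Sum>i. hnorm H (f i) * hnorm H (g i))"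
  using assms unfolding weak_factorization_def
  by (intro suminf_nonneg) (auto simp: hnorm_nonneg)

lemma weak_product_norm_le:
  assumes "weak_factorization H h f g"
  shows "weak_product_norm H h \<le> (\<Sum>i. hnorm H (f i) * hnorm H (g i))"
  unfolding weak_product_norm_def
  by (rule cInf_lower) (use assms weak_factorization_suminf_nonneg in \<open>auto intro!: bdd_belowI\<close>)

lemma weak_product_norm_nonneg:
  assumes "h \<in> weak_product H"
  shows "0 \<le> weak_product_norm H h"
  unfolding weak_product_norm_def
  by (rule cInf_greatest)
    (use assms weak_factorization_suminf_nonneg in \<open>auto simp: weak_product_def\<close>)

text \<open>Dropping the first \<open>n\<close> products leaves a factorization of the remainder,
  whose weak product norm is therefore at most a tail of a convergent series; boundedness of
  \<open>L\<close> sends its values to 0. So \<open>L\<close> is determined by its values on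
  products.\<close>

lemma weak_product_dual_sums:
  assumes L: "L \<in> weak_product_dual H" and fac: "weak_factorization H h f g"
  shows "(\<lambda>i. L (\<lambda>x. f i x * g i x)) sums L h"
proof -
  obtain C where C: "\<And>h. h \<in> weak_product H \<Longrightarrow> cmod (L h) \<le> C * weak_product_norm H h"
    and add: "\<And>f g. f \<in> weak_product H \<Longrightarrow> g \<in> weak_product H \<Longrightarrow> L (\<lambda>x. f x + g x) = L f + L g"
    using L unfolding weak_product_dual_def linear_functional_on_def by blast
  define t where "t n = (\<lambda>x. h x - (\<Sum>i<n. f i x * g i x))" for n
  have t_fac: "weak_factorization H (t n) (\<lambda>i. f (i + n)) (\<lambda>i. g (i + n))" for n
    unfolding t_def by (rule weak_factorization_tail[OF fac])
  have t_mem: "t n \<in> weak_product H" for n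
    using t_fac weak_product_def by blast
  have fg: "(\<lambda>x. f i x * g i x) \<in> weak_product H" for i
    using fac by (auto simp: weak_factorization_def intro: product_mem_weak_product)
  have partial: "L h = (\<Sum>i<n. L (\<lambda>x. f i x * g i x)) + L (t n)" for n
  proof (induction n)
    case 0
    then show ?case by (simp add: t_def)
  next
    case (Suc n)
    have "t n = (\<lambda>x. f n x * g n x + t (Suc n) x)"
      by (auto simp: t_def)
    then have "L (t n) = L (\<lambda>x. f n x * g n x) + L (t (Suc n))"
      using add[OF fg t_mem] by metis
    then show ?case using Suc by simp
  qed
  let ?a = "\<lambda>i. hnorm H (f i) * hnorm H (g i)"
  have sm: "summable ?a"
    using fac by (simp add: weak_factorization_def)
  \<comment> \<open>\<open>weak_product_dual\<close> puts no sign on its constant, hence the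
    absolute value.\<close>
  have tail: "cmod (L (t n)) \<le> \<bar>C\<bar> * (suminf ?a - (\<Sum>i<n. ?a i))" for n
  proof -
    have "cmod (L (t n)) \<le> \<bar>C\<bar> * weak_product_norm H (t n)"
      using C[OF t_mem] weak_product_norm_nonneg[OF t_mem]
      by (meson abs_ge_self mult_right_mono order_trans)
    also have "\<dots> \<le> \<bar>C\<bar> * (\<Sum>i. ?a (i + n))"
      using weak_product_norm_le[OF t_fac] by (intro mult_left_mono) auto
    finally show ?thesis
      using suminf_minus_initial_segment[OF sm, of n] by simp
  qed
  have "(\<lambda>n. \<bar>C\<bar> * (suminf ?a - (\<Sum>i<n. ?a i))) \<longlonglongrightarrow> \<bar>C\<bar> * (suminf ?a - suminf ?a)"
    by (intro tendsto_intros summable_LIMSEQ sm)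
  then have "(\<lambda>n. L (t n)) \<longlonglongrightarrow> 0"
    by (intro Lim_null_comparison[OF always_eventually[OF allI[OF tail]]]) simp
  then have "(\<lambda>n. L h - L (t n)) \<longlonglongrightarrow> L h - 0"
    by (intro tendsto_intros)
  moreover have "(\<lambda>n. L h - L (t n)) = (\<lambda>n. \<Sum>i<n. L (\<lambda>x. f i x * g i x))"
    using partial by (metis add_diff_cancel_right')
  ultimately show ?thesis
    by (simp add: sums_def)
qed

text \<open>Two such functionals agree on products, hence on sums of products by
  \<open>weak_product_dual_sums\<close>; elsewhere both are zero by convention. This gives meaning
  to the \<open>THE\<close> in \<open>hankel_pairing\<close>.\<close>

lemma hankel_functional_unique:
  assumes "hankel_functional_of H T L" "hankel_functional_of H T L'"
  shows "L = L'"
proof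
  fix h
  show "L h = L' h"
  proof (cases "h \<in> weak_product H")
    case True
    then obtain f g where fac: "weak_factorization H h f g"
      by (auto simp: weak_product_def)
    have "L (\<lambda>x. f i x * g i x) = L' (\<lambda>x. f i x * g i x)" for i
      using assms fac by (simp add: hankel_functional_of_def weak_factorization_def)
    moreover have "(\<lambda>i. L (\<lambda>x. f i x * g i x)) sums L h" "(\<lambda>i. L' (\<lambda>x. f i x * g i x)) sums L' h"
      using assms weak_product_dual_sums[OF _ fac] by (auto simp: hankel_functional_of_def)
    ultimately show ?thesis
      using sums_unique2 by simp
  next
    case False
    then show ?thesis
      using assms by (simp add: hankel_functional_of_def weak_product_dual_def)
  qed
qed

lemma hankel_pairing_eq:
  assumes "hankel_functional_of H T L"
  shows "hankel_pairing H h T = L h"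
  unfolding hankel_pairing_def
  by (rule arg_cong[where f = "\<lambda>L. L h"], rule the_equality)
    (use assms hankel_functional_unique in auto)

text \<open>The multiplier is absorbed into the left factors, whose norms do not grow.\<close>

lemma weak_factorization_mult:
  assumes \<psi>: "contractive_multiplier H \<psi>" and fac: "weak_factorization H h f g"
  shows "weak_factorization H (\<lambda>x. \<psi> x * h x) (\<lambda>i x. \<psi> x * f i x) g"
proof -
  have "summable (\<lambda>i. hnorm H (\<lambda>x. \<psi> x * f i x) * hnorm H (g i))"
  proof (rule summable_comparison_test')
    show "summable (\<lambda>i. hnorm H (f i) * hnorm H (g i))"
      using fac by (simp add: weak_factorization_def)
    show "norm (hnorm H (\<lambda>x. \<psi> x * f i x) * hnorm H (g i)) \<le> hnorm H (f i) * hnorm H (g i)" for i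
      using fac \<psi> by (auto simp: weak_factorization_def contractive_multiplier_def hnorm_nonneg mult_right_mono)
  qed
  then show ?thesis
    using fac \<psi> unfolding weak_factorization_def contractive_multiplier_def
    by (auto simp: mult.assoc intro: sums_mult)
qed

lemma weak_product_mult:
  assumes "contractive_multiplier H \<psi>" "h \<in> weak_product H"
  shows "(\<lambda>x. \<psi> x * h x) \<in> weak_product H"
  using assms weak_factorization_mult unfolding weak_product_def by blast

lemma weak_product_norm_mult:
  assumes \<psi>: "contractive_multiplier H \<psi>" and h: "h \<in> weak_product H"
  shows "weak_product_norm H (\<lambda>x. \<psi> x * h x) \<le> weak_product_norm H h"
  unfolding weak_product_norm_def[of H h]
proof (rule cInf_greatest)
  show "{\<Sum>i. hnorm H (f i) * hnorm H (g i) | f g. weak_factorization H h f g} \<noteq> {}"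
    using h by (auto simp: weak_product_def)
next
  fix s assume "s \<in> {\<Sum>i. hnorm H (f i) * hnorm H (g i) | f g. weak_factorization H h f g}"
  then obtain f g where s: "s = (\<Sum>i. hnorm H (f i) * hnorm H (g i))"
    and fac: "weak_factorization H h f g" by blast
  note fac' = weak_factorization_mult[OF \<psi> fac]
  have "weak_product_norm H (\<lambda>x. \<psi> x * h x) \<le> (\<Sum>i. hnorm H (\<lambda>x. \<psi> x * f i x) * hnorm H (g i))"
    by (rule weak_product_norm_le[OF fac'])
  also have "\<dots> \<le> s"
    unfolding s
    using fac fac' \<psi>
    by (intro suminf_le)
      (auto simp: weak_factorization_def contractive_multiplier_def hnorm_nonneg intro!: mult_right_mono)
  finally show "weak_product_norm H (\<lambda>x. \<psi> x * h x) \<le> s" .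
qed

end

section \<open>Multipliers acting on the weak product and on Hankel operators\<close>

lemma interleave_sums:
  fixes g :: "nat \<Rightarrow> complex"
  assumes "g sums x" "f sums y"
  shows "(\<lambda>n. if even n then f (n div 2) else g ((n - 1) div 2)) sums (x + y)"
  using sums_if[of "\<lambda>n. Re (g n)" "Re x" "\<lambda>n. Re (f n)" "Re y"]
    sums_if[of "\<lambda>n. Im (g n)" "Im x" "\<lambda>n. Im (f n)" "Im y"] assms
  unfolding sums_complex_iff by (simp add: if_distrib[of Re] if_distrib[of Im])

context semi_inner_fspace
begin

text \<open>Two factorizations are interleaved into one. Closure matters because functionals are cut
  off to zero outside the weak product: linearity of a cut-off functional is only available if sums
  stay inside.\<close>

lemma weak_product_add:
  assumes "h \<in> weak_product H" "k \<in> weak_product H"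
  shows "(\<lambda>x. h x + k x) \<in> weak_product H"
proof -
  obtain f g where fg: "weak_factorization H h f g"
    using assms by (auto simp: weak_product_def)
  obtain u v where uv: "weak_factorization H k u v"
    using assms by (auto simp: weak_product_def)
  define f' where "f' n = (if even n then u (n div 2) else f ((n - 1) div 2))" for n
  define g' where "g' n = (if even n then v (n div 2) else g ((n - 1) div 2))" for n
  have "weak_factorization H (\<lambda>x. h x + k x) f' g'"
    unfolding weak_factorization_def
  proof (intro conjI allI)
    show "f' i \<in> carr H" "g' i \<in> carr H" for i
      using fg uv by (auto simp: weak_factorization_def f'_def g'_def)
    have "(\<lambda>n. if even n then hnorm H (u (n div 2)) * hnorm H (v (n div 2))
        else hnorm H (f ((n - 1) div 2)) * hnorm H (g ((n - 1) div 2))) sums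
        ((\<Sum>i. hnorm H (f i) * hnorm H (g i)) + (\<Sum>i. hnorm H (u i) * hnorm H (v i)))"
      using fg uv unfolding weak_factorization_def by (intro sums_if summable_sums) auto
    moreover have "(\<lambda>n. if even n then hnorm H (u (n div 2)) * hnorm H (v (n div 2))
        else hnorm H (f ((n - 1) div 2)) * hnorm H (g ((n - 1) div 2)))
        = (\<lambda>n. hnorm H (f' n) * hnorm H (g' n))"
      by (auto simp: f'_def g'_def)
    ultimately show "summable (\<lambda>n. hnorm H (f' n) * hnorm H (g' n))"
      by (simp add: sums_iff)
    have "(\<lambda>n. if even n then u (n div 2) x * v (n div 2) x
        else f ((n - 1) div 2) x * g ((n - 1) div 2) x) sums (h x + k x)" for x
      using fg uv unfolding weak_factorization_def by (intro interleave_sums) auto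
    moreover have "(\<lambda>n. if even n then u (n div 2) x * v (n div 2) x
        else f ((n - 1) div 2) x * g ((n - 1) div 2) x) = (\<lambda>n. f' n x * g' n x)" for x
      by (auto simp: f'_def g'_def)
    ultimately show "(\<lambda>n. f' n x * g' n x) sums (h x + k x)" for x
      by simp
  qed
  then show ?thesis
    by (auto simp: weak_product_def)
qed

lemma weak_product_scale:
  assumes "h \<in> weak_product H"
  shows "(\<lambda>x. c * h x) \<in> weak_product H"
proof -
  obtain f g where fg: "weak_factorization H h f g"
    using assms by (auto simp: weak_product_def)
  have "weak_factorization H (\<lambda>x. c * h x) (\<lambda>i x. c * f i x) g"
    using fg unfolding weak_factorization_def
    by (auto simp: scale_mem hnorm_scale mult.assoc intro: summable_mult sums_mult)
  then show ?thesis
    by (auto simp: weak_product_def)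
qed

text \<open>The form of \<open>T\<close> composed with multiplication by \<open>\<psi>\<close> is
  \<open>L\<close> at \<open>\<psi> f g\<close>, so its functional is \<open>L\<close> after
  multiplication by \<open>\<psi>\<close>, which does not increase the weak product norm.\<close>

lemma hankel_functional_mult_right:
  assumes \<psi>: "contractive_multiplier H \<psi>" and T: "hankel_functional_of H T L"
  shows "hankel_functional_of H (mult_right H T \<psi>)
           (\<lambda>h. if h \<in> weak_product H then L (\<lambda>x. \<psi> x * h x) else 0)"
proof -
  let ?L = "\<lambda>h. if h \<in> weak_product H then L (\<lambda>x. \<psi> x * h x) else 0"
  have L: "L \<in> weak_product_dual H"
    using T by (simp add: hankel_functional_of_def)
  then have lin: "linear_functional_on (weak_product H) L"
    by (simp add: weak_product_dual_def)
  obtain C where C: "\<And>h. h \<in> weak_product H \<Longrightarrow> cmod (L h) \<le> C * weak_product_norm H h"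
    using L by (auto simp: weak_product_dual_def)
  have "linear_functional_on (weak_product H) ?L"
    using lin weak_product_mult[OF \<psi>]
    by (auto simp: linear_functional_on_def weak_product_add weak_product_scale distrib_left
        mult.left_commute[of _ "_ :: complex"])
  moreover have "cmod (?L h) \<le> \<bar>C\<bar> * weak_product_norm H h" if "h \<in> weak_product H" for h
  proof -
    have "cmod (?L h) \<le> C * weak_product_norm H (\<lambda>x. \<psi> x * h x)"
      using that C weak_product_mult[OF \<psi>] by simp
    also have "\<dots> \<le> \<bar>C\<bar> * weak_product_norm H h"
      using that weak_product_norm_mult[OF \<psi>] weak_product_norm_nonneg weak_product_mult[OF \<psi>]
      by (intro mult_mono) auto
    finally show ?thesis .
  qed
  ultimately have "?L \<in> weak_product_dual H"
    unfolding weak_product_dual_def by auto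
  moreover have "ip (conj_space H) (mult_right H T \<psi> f) (cnj_fun g) = ?L (\<lambda>x. f x * g x)"
    if "f \<in> carr H" "g \<in> carr H" for f g
    using that T \<psi>
    by (simp add: product_mem_weak_product mult_right_def hankel_functional_of_def
        contractive_multiplier_def mult.assoc)
  ultimately show ?thesis
    by (simp add: hankel_functional_of_def)
qed

text \<open>Right multiplication on Hankel operators is the pre-adjoint of multiplication on the
  weak product. Through this identity bounds over \<open>HAN0\<close> become bounds for multipliers
  of the weak product.\<close>

lemma hankel_pairing_mult_right:
  assumes \<psi>: "contractive_multiplier H \<psi>" and T: "T \<in> HAN H" and h: "h \<in> weak_product H"
  shows "hankel_pairing H h (mult_right H T \<psi>) = hankel_pairing H (\<lambda>x. \<psi> x * h x) T"
proof -
  obtain L where L: "hankel_functional_of H T L"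
    using T by (auto simp: HAN_def)
  show ?thesis
    unfolding hankel_pairing_eq[OF L] hankel_pairing_eq[OF hankel_functional_mult_right[OF \<psi> L]]
    using h by simp
qed

text \<open>Compactness survives because multiplication by \<open>\<psi>\<close> maps the unit ball
  into itself, so compactness of \<open>T\<close> can be applied to the sequence
  \<open>\<psi> F n\<close>.\<close>

lemma mult_right_HAN0:
  assumes \<psi>: "contractive_multiplier H \<psi>" and T: "T \<in> HAN0 H"
  shows "mult_right H T \<psi> \<in> HAN0 H"
proof -
  have \<psi>_mem: "\<And>f. f \<in> carr H \<Longrightarrow> (\<lambda>x. \<psi> x * f x) \<in> carr H"
    and \<psi>_le: "\<And>f. f \<in> carr H \<Longrightarrow> hnorm H (\<lambda>x. \<psi> x * f x) \<le> hnorm H f"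
    using \<psi> by (auto simp: contractive_multiplier_def)
  have T_mem: "\<And>f. f \<in> carr H \<Longrightarrow> T f \<in> carr (conj_space H)"
    and lin: "linear_map_on (carr H) T"
    using T by (auto simp: HAN0_def HAN_def bounded_ops_def)
  obtain C where C: "\<And>f. f \<in> carr H \<Longrightarrow> hnorm (conj_space H) (T f) \<le> C * hnorm H f"
    using T by (auto simp: HAN0_def HAN_def bounded_ops_def)
  have "linear_map_on (carr H) (mult_right H T \<psi>)"
    using lin \<psi>_mem
    by (auto simp: linear_map_on_def mult_right_def add_mem scale_mem distrib_left
        mult.left_commute[of _ "_ :: complex"])
  moreover have "hnorm (conj_space H) (mult_right H T \<psi> f) \<le> \<bar>C\<bar> * hnorm H f" if "f \<in> carr H" for f
  proof -
    have "hnorm (conj_space H) (mult_right H T \<psi> f) \<le> C * hnorm H (\<lambda>x. \<psi> x * f x)"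
      using that C \<psi>_mem by (simp add: mult_right_def)
    also have "\<dots> \<le> \<bar>C\<bar> * hnorm H f"
      using that \<psi>_le \<psi>_mem hnorm_nonneg by (intro mult_mono) auto
    finally show ?thesis .
  qed
  ultimately have "mult_right H T \<psi> \<in> bounded_ops H (conj_space H)"
    unfolding bounded_ops_def using T_mem \<psi>_mem by (auto simp: mult_right_def)
  moreover have "\<exists>L. hankel_functional_of H (mult_right H T \<psi>) L"
    using T hankel_functional_mult_right[OF \<psi>] by (auto simp: HAN0_def HAN_def)
  moreover have "compact_op H (conj_space H) (mult_right H T \<psi>)"
    unfolding compact_op_def
  proof (intro allI impI)
    fix F :: "nat \<Rightarrow> 'x \<Rightarrow> complex"
    assume F: "\<forall>n. F n \<in> carr H \<and> hnorm H (F n) \<le> 1"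
    then have "\<forall>n. (\<lambda>x. \<psi> x * F n x) \<in> carr H \<and> hnorm H (\<lambda>x. \<psi> x * F n x) \<le> 1"
      using \<psi>_mem \<psi>_le order_trans by blast
    then obtain r g where "strict_mono r" "g \<in> carr (conj_space H)"
      "(\<lambda>n. hnorm (conj_space H) (\<lambda>y. T (\<lambda>x. \<psi> x * F (r n) x) y - g y)) \<longlonglongrightarrow> 0"
      using T unfolding HAN0_def compact_op_def by (auto dest!: spec[of _ "\<lambda>n x. \<psi> x * F n x"])
    then show "\<exists>r g. strict_mono r \<and> g \<in> carr (conj_space H) \<and>
        (\<lambda>n. hnorm (conj_space H) (\<lambda>x. mult_right H T \<psi> (F (r n)) x - g x)) \<longlonglongrightarrow> 0"
      using F by (auto simp: mult_right_def)
  qed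
  ultimately show ?thesis
    by (auto simp: HAN0_def HAN_def)
qed

end

section \<open>Matrices of multipliers\<close>

text \<open>Contractivity on \<open>H^k\<close> as an inequality of finite real sums, which avoids
  the suprema in \<open>ennreal\<close> of \<open>op_matrix_norm\<close>.\<close>

definition contractive_matrix ::
  "'x fspace \<Rightarrow> nat \<Rightarrow> (nat \<Rightarrow> nat \<Rightarrow> 'x \<Rightarrow> complex) \<Rightarrow> bool" where
  "contractive_matrix H k A \<longleftrightarrow>
     (\<forall>i<k. \<forall>j<k. \<forall>f\<in>carr H. (\<lambda>x. A i j x * f x) \<in> carr H) \<and>
     (\<forall>g. (\<forall>j<k. g j \<in> carr H) \<longrightarrow>
        (\<Sum>i<k. (hnorm H (\<lambda>x. \<Sum>j<k. A i j x * g j x))\<^sup>2) \<le> (\<Sum>j<k. (hnorm H (g j))\<^sup>2))"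

section \<open>Index bookkeeping for matrices of matrices\<close>

lemma sum_div_mod:
  fixes F :: "nat \<Rightarrow> nat \<Rightarrow> 'a::comm_monoid_add"
  assumes "0 < k"
  shows "(\<Sum>p<l * k. F (p div k) (p mod k)) = (\<Sum>c<l. \<Sum>i<k. F c i)"
proof -
  have "(\<Sum>i = c * k..<c * k + k. F (i div k) (i mod k)) = (\<Sum>i<k. F c i)" for c
  proof -
    have "(\<Sum>i = c * k..<c * k + k. F (i div k) (i mod k))
        = (\<Sum>i = 0..<k. F ((i + c * k) div k) ((i + c * k) mod k))"
      using sum.shift_bounds_nat_ivl[of "\<lambda>i. F (i div k) (i mod k)" 0 "c * k" k]
      by (simp add: add.commute)
    also have "\<dots> = (\<Sum>i<k. F c i)"
      using assms by (intro sum.cong) auto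
    finally show ?thesis .
  qed
  then show ?thesis
    using sum.nat_group[of "\<lambda>p. F (p div k) (p mod k)" k l] by simp
qed

lemma complex_matrix_norm_cong:
  assumes "\<And>p q. p < n \<Longrightarrow> q < n \<Longrightarrow> B p q = B' p q"
  shows "complex_matrix_norm n B = complex_matrix_norm n B'"
proof -
  have "(\<Sum>i<n. (cmod (\<Sum>j<n. B i j * v j))\<^sup>2) = (\<Sum>i<n. (cmod (\<Sum>j<n. B' i j * v j))\<^sup>2)" for v
    using assms by (intro sum.cong) auto
  then show ?thesis by (simp add: complex_matrix_norm_def)
qed

text \<open>Reordering rows and columns simultaneously only renames the test vector:
  \<open>v\<close> is replaced by \<open>v\<close> after the inverse of
  \<open>\<sigma>\<close>.\<close>

lemma complex_matrix_norm_permute: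
  assumes "bij_betw \<sigma> {..<n} {..<n}"
  shows "complex_matrix_norm n (\<lambda>p q. B (\<sigma> p) (\<sigma> q)) \<le> complex_matrix_norm n B"
  unfolding complex_matrix_norm_def
proof (rule Sup_mono, clarify)
  fix v :: "nat \<Rightarrow> complex"
  assume v: "(\<Sum>j<n. (cmod (v j))\<^sup>2) \<le> 1"
  let ?\<tau> = "inv_into {..<n} \<sigma>"
  have inv: "?\<tau> (\<sigma> j) = j" if "j < n" for j
    using assms that by (auto simp: bij_betw_def inv_into_f_f)
  have "(\<Sum>j<n. (cmod (v (?\<tau> j)))\<^sup>2) = (\<Sum>j<n. (cmod (v (?\<tau> (\<sigma> j))))\<^sup>2)"
    by (rule sum.reindex_bij_betw[OF assms, symmetric])
  also have "\<dots> \<le> 1" using v by (simp add: inv)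
  finally have v': "(\<Sum>j<n. (cmod (v (?\<tau> j)))\<^sup>2) \<le> 1" .
  have "(\<Sum>i<n. (cmod (\<Sum>j<n. B i j * v (?\<tau> j)))\<^sup>2)
      = (\<Sum>i<n. (cmod (\<Sum>j<n. B (\<sigma> i) j * v (?\<tau> j)))\<^sup>2)"
    by (rule sum.reindex_bij_betw[OF assms, symmetric])
  also have "\<dots> = (\<Sum>i<n. (cmod (\<Sum>j<n. B (\<sigma> i) (\<sigma> j) * v (?\<tau> (\<sigma> j))))\<^sup>2)"
    by (subst sum.reindex_bij_betw[OF assms, symmetric]) simp
  also have "\<dots> = (\<Sum>i<n. (cmod (\<Sum>j<n. B (\<sigma> i) (\<sigma> j) * v j))\<^sup>2)"
    by (simp add: inv)
  finally show "\<exists>y\<in>{ennreal (sqrt (\<Sum>i<n. (cmod (\<Sum>j<n. B i j * v j))\<^sup>2)) |v. (\<Sum>j<n. (cmod (v j))\<^sup>2) \<le> 1}.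
      ennreal (sqrt (\<Sum>i<n. (cmod (\<Sum>j<n. B (\<sigma> i) (\<sigma> j) * v j))\<^sup>2)) \<le> y"
    using v' by (intro bexI[where x = "ennreal (sqrt (\<Sum>i<n. (cmod (\<Sum>j<n. B i j * v (?\<tau> j)))\<^sup>2))"] CollectI
        exI[where x = "\<lambda>j. v (?\<tau> j)"]) simp_all
qed

text \<open>In mixed radix, \<open>p = (c * m + a) * k + i\<close> goes to
  \<open>(c * k + i) * m + a\<close>: the two inner digits trade places. Pairing \<open>T\<close>
  with the amplified product orders the indices as (\<open>T\<close>, \<open>h\<close>,
  \<open>A\<close>), while pairing \<open>h\<close> with the amplified operator matrix orders them
  as (\<open>T\<close>, \<open>A\<close>, \<open>h\<close>).\<close>

definition swap_index :: "nat \<Rightarrow> nat \<Rightarrow> nat \<Rightarrow> nat" where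
  "swap_index m k p = (p div (m * k) * k + p mod k) * m + p mod (m * k) div k"

lemma swap_index:
  assumes "0 < m" "0 < k"
  shows swap_index_mod: "swap_index m k p mod m = p mod (m * k) div k"
    and swap_index_div_div: "swap_index m k p div m div k = p div (m * k)"
    and swap_index_div_mod: "swap_index m k p div m mod k = p mod k"
    and bij_swap_index: "bij_betw (swap_index m k) {..<l * (m * k)} {..<l * (m * k)}"
proof -
  have lt: "p mod (m * k) div k < m" for p
    using assms by (simp add: less_mult_imp_div_less)
  show md: "swap_index m k p mod m = p mod (m * k) div k" for p
    using lt by (simp add: swap_index_def)
  have dv: "swap_index m k p div m = p div (m * k) * k + p mod k" for p
    using lt[of p] by (simp add: swap_index_def)
  show dd: "swap_index m k p div m div k = p div (m * k)" for p
    using assms by (simp add: dv)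
  show dm: "swap_index m k p div m mod k = p mod k" for p
    using assms by (simp add: dv)
  have "inj (swap_index m k)"
  proof (rule injI)
    fix p q assume eq: "swap_index m k p = swap_index m k q"
    have "p mod (m * k) = q mod (m * k)"
      using md[of p] md[of q] dm[of p] dm[of q] eq
      by (metis div_mult_mod_eq mod_mult_self2 mod_mod_cancel dvd_triv_right)
    moreover have "p div (m * k) = q div (m * k)"
      using dd[of p] dd[of q] eq by simp
    ultimately show "p = q"
      by (metis div_mult_mod_eq)
  qed
  moreover have "swap_index m k ` {..<l * (m * k)} \<subseteq> {..<l * (m * k)}"
  proof clarify
    fix p assume "p < l * (m * k)"
    then have "p div (m * k) < l"
      by (simp add: less_mult_imp_div_less)
    then have "swap_index m k p div m div k < l"
      by (simp add: dd)
    then show "swap_index m k p < l * (m * k)"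
      using assms by (simp add: div_less_iff_less_mult mult_ac)
  qed
  ultimately show "bij_betw (swap_index m k) {..<l * (m * k)} {..<l * (m * k)}"
    by (metis bij_betw_def endo_inj_surj finite_lessThan inj_on_subset subset_UNIV)
qed

section \<open>Contractive transposes act contractively on Hankel matrices, the weak product and its
  multipliers\<close>

context semi_inner_fspace
begin

text \<open>The unit-ball condition in homogeneous form, with the output conjugated back into
  \<open>H\<close> so that only one inner product occurs later.\<close>

lemma op_matrix_norm_le_1D:
  assumes lin: "\<And>i j. i < n \<Longrightarrow> j < n \<Longrightarrow> T i j \<in> bounded_ops H (conj_space H)"
    and le: "op_matrix_norm H (conj_space H) n T \<le> 1"
    and f: "\<And>j. j < n \<Longrightarrow> f j \<in> carr H"
  shows "(\<Sum>i<n. (hnorm H (\<lambda>x. \<Sum>j<n. cnj_fun (T i j (f j)) x))\<^sup>2) \<le> (\<Sum>j<n. (hnorm H (f j))\<^sup>2)"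
proof -
  define X where "X = (\<Sum>i<n. (hnorm H (\<lambda>x. \<Sum>j<n. cnj_fun (T i j (f j)) x))\<^sup>2)"
  define Y where "Y = (\<Sum>j<n. (hnorm H (f j))\<^sup>2)"
  have mem: "cnj_fun (T i j (f j)) \<in> carr H" if "i < n" "j < n" for i j
    using lin[OF that] f that by (auto simp: bounded_ops_def carr_conj_space_iff)
  have "Y \<ge> 0" by (auto simp: Y_def intro: sum_nonneg)
  have "X \<le> Y + e" if "e > 0" for e
  proof -
    \<comment> \<open>Since \<open>Y\<close> may be 0, the vector is normalised by
      \<open>Y + e\<close>, and \<open>e\<close> is removed at the end.\<close>
    define t where "t = 1 / sqrt (Y + e)"
    have t: "t > 0" "t\<^sup>2 = 1 / (Y + e)"
      using \<open>Y \<ge> 0\<close> that by (auto simp: t_def power_divide)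
    define u where "u j = (\<lambda>x. of_real t * f j x)" for j
    have u: "u j \<in> carr H" if "j < n" for j
      using f that by (simp add: u_def scale_mem)
    have "(\<Sum>j<n. (hnorm H (u j))\<^sup>2) = (\<Sum>j<n. t\<^sup>2 * (hnorm H (f j))\<^sup>2)"
      using f t by (intro sum.cong) (auto simp: u_def hnorm_scale power_mult_distrib)
    also have "\<dots> = Y / (Y + e)"
      by (simp add: Y_def t flip: sum_distrib_left sum_divide_distrib)
    also have "\<dots> \<le> 1" using \<open>Y \<ge> 0\<close> that by simp
    finally have u1: "(\<Sum>j<n. (hnorm H (u j))\<^sup>2) \<le> 1" .
    have "ennreal (sqrt (\<Sum>i<n. (hnorm (conj_space H) (\<lambda>x. \<Sum>j<n. T i j (u j) x))\<^sup>2)) \<le> 1"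
      using u u1 by (intro order_trans[OF Sup_upper le[unfolded op_matrix_norm_def]]) auto
    then have le1: "(\<Sum>i<n. (hnorm (conj_space H) (\<lambda>x. \<Sum>j<n. T i j (u j) x))\<^sup>2) \<le> 1"
      by (simp add: ennreal_le_1)
    have "hnorm (conj_space H) (\<lambda>x. \<Sum>j<n. T i j (u j) x)
        = t * hnorm H (\<lambda>x. \<Sum>j<n. cnj_fun (T i j (f j)) x)" if "i < n" for i
    proof -
      have "T i j (u j) = (\<lambda>x. of_real t * T i j (f j) x)" if "j < n" for j
        using lin[OF \<open>i < n\<close> that] f[OF that]
        by (auto simp: bounded_ops_def linear_map_on_def u_def)
      then have "cnj_fun (\<lambda>x. \<Sum>j<n. T i j (u j) x)
          = (\<lambda>x. of_real t * (\<Sum>j<n. cnj_fun (T i j (f j)) x))"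
        by (auto simp: cnj_fun_def sum_distrib_left)
      then show ?thesis
        using t hnorm_scale[OF sum_mem[of "{..<n}" "\<lambda>j. cnj_fun (T i j (f j))"], of "of_real t"] mem that
        by (simp add: hnorm_conj_space)
    qed
    then have "t\<^sup>2 * X \<le> 1"
      using le1 by (simp add: X_def power_mult_distrib flip: sum_distrib_left)
    then show "X \<le> Y + e"
      using \<open>Y \<ge> 0\<close> that by (simp add: t field_simps)
  qed
  then show ?thesis
    using field_le_epsilon X_def Y_def by blast
qed

text \<open>Test on a vector supported in slot \<open>j\<close> and keep only row \<open>i\<close>
  of the output.\<close>

lemma contractive_matrix_entry:
  assumes A: "contractive_matrix H k A" and "i < k" "j < k"
  shows "contractive_multiplier H (A i j)"
  unfolding contractive_multiplier_def
proof (intro ballI conjI)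
  fix f assume f: "f \<in> carr H"
  show m: "(\<lambda>x. A i j x * f x) \<in> carr H"
    using A assms f by (simp add: contractive_matrix_def)
  let ?g = "\<lambda>l. if l = j then f else (\<lambda>x. 0)"
  have eq: "(\<lambda>x. \<Sum>l<k. A i' l x * ?g l x) = (\<lambda>x. A i' j x * f x)" for i'
    using \<open>j < k\<close> by (auto simp: if_distribR sum.delta' if_distrib cong: if_cong)
  have "(hnorm H (\<lambda>x. A i j x * f x))\<^sup>2 \<le> (\<Sum>i<k. (hnorm H (\<lambda>x. A i j x * f x))\<^sup>2)"
    by (rule member_le_sum) (use \<open>i < k\<close> in auto)
  also have "\<dots> = (\<Sum>i<k. (hnorm H (\<lambda>x. \<Sum>l<k. A i l x * ?g l x))\<^sup>2)"
    by (simp only: eq)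
  also have "\<dots> \<le> (\<Sum>l<k. (hnorm H (?g l))\<^sup>2)"
    using A f zero_mem unfolding contractive_matrix_def by auto
  also have "\<dots> = (\<Sum>l<k. if l = j then (hnorm H f)\<^sup>2 else 0)"
    by (intro sum.cong) (auto simp: hnorm_zero)
  also have "\<dots> = (hnorm H f)\<^sup>2"
    using \<open>j < k\<close> by simp
  finally show "hnorm H (\<lambda>x. A i j x * f x) \<le> hnorm H f"
    using hnorm_nonneg[OF f] by (rule power2_le_imp_le)
qed

text \<open>With \<open>u\<close> the output, moving every multiplier to the other side of the form
  turns \<open>X\<close>, the sum of all squared norms of \<open>u\<close>, into a sum of inner
  products of \<open>v\<close> and \<open>w\<close>. Here \<open>v\<close> is the transpose of
  \<open>A\<close> applied to \<open>u\<close>, and \<open>w\<close> is \<open>T\<close> applied to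
  the unmultiplied \<open>f\<close>. Contractivity of each gives
  \<open>X <= sqrt X * sqrt Y\<close>. The row index \<open>i\<close> of \<open>A\<close> is the one
  summed over in \<open>v\<close>, which is why the hypothesis concerns the transpose.\<close>

lemma hankel_matrix_bound:
  assumes T: "\<And>c d. c < l \<Longrightarrow> d < l \<Longrightarrow> T c d \<in> HAN H"
    and le: "op_matrix_norm H (conj_space H) l T \<le> 1"
    and A: "contractive_matrix H k (\<lambda>i j. A j i)"
    and f: "\<And>d j. d < l \<Longrightarrow> j < k \<Longrightarrow> f d j \<in> carr H"
  shows "(\<Sum>c<l. \<Sum>i<k. (hnorm H (\<lambda>x. \<Sum>d<l. \<Sum>j<k. cnj_fun (T c d (\<lambda>x. A i j x * f d j x)) x))\<^sup>2)
           \<le> (\<Sum>d<l. \<Sum>j<k. (hnorm H (f d j))\<^sup>2)"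
proof -
  define u where "u c i = (\<lambda>x. \<Sum>d<l. \<Sum>j<k. cnj_fun (T c d (\<lambda>x. A i j x * f d j x)) x)" for c i
  define X where "X = (\<Sum>c<l. \<Sum>i<k. (hnorm H (u c i))\<^sup>2)"
  define Y where "Y = (\<Sum>d<l. \<Sum>j<k. (hnorm H (f d j))\<^sup>2)"
  have A_mem: "(\<lambda>x. A i j x * g x) \<in> carr H" if "i < k" "j < k" "g \<in> carr H" for i j g
    using A that by (simp add: contractive_matrix_def)
  have bdd: "T c d \<in> bounded_ops H (conj_space H)" if "c < l" "d < l" for c d
    using T that by (auto simp: HAN_def)
  have T_mem: "cnj_fun (T c d g) \<in> carr H" if "c < l" "d < l" "g \<in> carr H" for c d g
    using bdd that by (auto simp: bounded_ops_def carr_conj_space_iff)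
  have u_mem: "u c i \<in> carr H" if "c < l" "i < k" for c i
    unfolding u_def using that by (intro sum_mem) (auto intro!: T_mem A_mem f)
  define w where "w c j = (\<lambda>x. \<Sum>d<l. cnj_fun (T c d (f d j)) x)" for c j
  have w_mem: "w c j \<in> carr H" if "c < l" "j < k" for c j
    unfolding w_def using that by (intro sum_mem) (auto intro!: T_mem f)
  define v where "v c j = (\<lambda>x. \<Sum>i<k. A i j x * u c i x)" for c j
  have v_mem: "v c j \<in> carr H" if "c < l" "j < k" for c j
    unfolding v_def using that by (intro sum_mem) (auto intro!: A_mem u_mem)
  \<comment> \<open>Both sides are the Hankel functional at the product of \<open>\<psi>\<close>,
    \<open>g\<close> and \<open>h\<close>.\<close>
  have move: "ip H g (cnj_fun (T c d (\<lambda>x. \<psi> x * h x))) = ip H (\<lambda>x. \<psi> x * g x) (cnj_fun (T c d h))"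
    if "c < l" "d < l" "g \<in> carr H" "h \<in> carr H" "(\<lambda>x. \<psi> x * g x) \<in> carr H" "(\<lambda>x. \<psi> x * h x) \<in> carr H"
    for c d g h \<psi>
  proof -
    have "T c d \<in> HAN H"
      using T that by blast
    then obtain L where "hankel_functional_of H (T c d) L"
      by (auto simp: HAN_def)
    then have "\<And>f g. f \<in> carr H \<Longrightarrow> g \<in> carr H \<Longrightarrow> ip H g (cnj_fun (T c d f)) = L (\<lambda>x. f x * g x)"
      by (auto simp: hankel_functional_of_def ip_conj_space)
    with that show ?thesis
      by (simp add: mult_ac)
  qed
  have ip_u: "ip H (u c i) (u c i) = (\<Sum>j<k. ip H (\<lambda>x. A i j x * u c i x) (w c j))"
    if "c < l" "i < k" for c i
  proof -
    have "ip H g (u c i) = (\<Sum>d<l. ip H g (\<lambda>x. \<Sum>j<k. cnj_fun (T c d (\<lambda>x. A i j x * f d j x)) x))"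
      if "g \<in> carr H" for g
      unfolding u_def
      by (rule ip_sum_right) (use that \<open>c < l\<close> \<open>i < k\<close> in \<open>auto intro!: sum_mem T_mem A_mem f\<close>)
    moreover have "(\<Sum>d<l. ip H g (\<lambda>x. \<Sum>j<k. cnj_fun (T c d (\<lambda>x. A i j x * f d j x)) x))
        = (\<Sum>d<l. \<Sum>j<k. ip H g (cnj_fun (T c d (\<lambda>x. A i j x * f d j x))))"
      if "g \<in> carr H" for g
      by (intro sum.cong refl ip_sum_right)
        (use that \<open>c < l\<close> \<open>i < k\<close> in \<open>auto intro!: sum_mem T_mem A_mem f\<close>)
    ultimately have "ip H (u c i) (u c i)
        = (\<Sum>d<l. \<Sum>j<k. ip H (u c i) (cnj_fun (T c d (\<lambda>x. A i j x * f d j x))))"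
      using that u_mem by simp
    also have "\<dots> = (\<Sum>d<l. \<Sum>j<k. ip H (\<lambda>x. A i j x * u c i x) (cnj_fun (T c d (f d j))))"
      using that by (intro sum.cong refl move) (auto intro!: A_mem u_mem f)
    also have "\<dots> = (\<Sum>j<k. \<Sum>d<l. ip H (\<lambda>x. A i j x * u c i x) (cnj_fun (T c d (f d j))))"
      by (rule sum.swap)
    also have "\<dots> = (\<Sum>j<k. ip H (\<lambda>x. A i j x * u c i x) (w c j))"
      unfolding w_def using that
      by (intro sum.cong refl ip_sum_right[symmetric]) (auto intro!: A_mem u_mem T_mem f)
    finally show ?thesis .
  qed
  have "complex_of_real X = (\<Sum>c<l. \<Sum>i<k. ip H (u c i) (u c i))"
    by (simp add: X_def ip_self u_mem)
  also have "\<dots> = (\<Sum>c<l. \<Sum>i<k. \<Sum>j<k. ip H (\<lambda>x. A i j x * u c i x) (w c j))"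
    by (intro sum.cong refl ip_u) auto
  also have "\<dots> = (\<Sum>c<l. \<Sum>j<k. \<Sum>i<k. ip H (\<lambda>x. A i j x * u c i x) (w c j))"
    by (intro sum.cong refl sum.swap)
  also have "\<dots> = (\<Sum>c<l. \<Sum>j<k. ip H (v c j) (w c j))"
    unfolding v_def by (intro sum.cong refl ip_sum_left[symmetric]) (auto intro!: A_mem u_mem w_mem)
  also have "\<dots> = (\<Sum>(c, j)\<in>{..<l} \<times> {..<k}. ip H (v c j) (w c j))"
    by (rule sum.cartesian_product)
  finally have "X = cmod (\<Sum>p\<in>{..<l} \<times> {..<k}. ip H (v (fst p) (snd p)) (w (fst p) (snd p)))"
    using norm_of_real[of X, where ?'a = complex]
    by (simp add: case_prod_beta X_def sum_nonneg)
  also have "\<dots> \<le> sqrt (\<Sum>p\<in>{..<l} \<times> {..<k}. (hnorm H (v (fst p) (snd p)))\<^sup>2)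
      * sqrt (\<Sum>p\<in>{..<l} \<times> {..<k}. (hnorm H (w (fst p) (snd p)))\<^sup>2)"
    by (rule Cauchy_Schwarz_sum) (auto intro: v_mem w_mem)
  also have "(\<Sum>p\<in>{..<l} \<times> {..<k}. (hnorm H (v (fst p) (snd p)))\<^sup>2) = (\<Sum>c<l. \<Sum>j<k. (hnorm H (v c j))\<^sup>2)"
    by (simp add: sum.cartesian_product case_prod_beta)
  also have "(\<Sum>p\<in>{..<l} \<times> {..<k}. (hnorm H (w (fst p) (snd p)))\<^sup>2) = (\<Sum>c<l. \<Sum>j<k. (hnorm H (w c j))\<^sup>2)"
    by (simp add: sum.cartesian_product case_prod_beta)
  also have "(\<Sum>c<l. \<Sum>j<k. (hnorm H (w c j))\<^sup>2) = (\<Sum>j<k. \<Sum>c<l. (hnorm H (w c j))\<^sup>2)"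
    by (rule sum.swap)
  also have "sqrt (\<Sum>c<l. \<Sum>j<k. (hnorm H (v c j))\<^sup>2) * sqrt (\<Sum>j<k. \<Sum>c<l. (hnorm H (w c j))\<^sup>2)
      \<le> sqrt X * sqrt Y"
  proof (intro mult_mono real_sqrt_le_mono)
    have "(\<Sum>j<k. (hnorm H (v c j))\<^sup>2) \<le> (\<Sum>i<k. (hnorm H (u c i))\<^sup>2)" if "c < l" for c
      using A u_mem[OF that] unfolding contractive_matrix_def v_def by blast
    then show "(\<Sum>c<l. \<Sum>j<k. (hnorm H (v c j))\<^sup>2) \<le> X"
      unfolding X_def by (rule sum_mono) simp
    \<comment> \<open>For a fixed slot \<open>j\<close>, the matrix \<open>T\<close> acts on the
      vector of all \<open>f d j\<close>; this is why the double sum for \<open>w\<close> was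
      swapped.\<close>
    have "(\<Sum>c<l. (hnorm H (w c j))\<^sup>2) \<le> (\<Sum>d<l. (hnorm H (f d j))\<^sup>2)" if "j < k" for j
      unfolding w_def using that by (intro op_matrix_norm_le_1D le bdd f)
    then have "(\<Sum>j<k. \<Sum>c<l. (hnorm H (w c j))\<^sup>2) \<le> (\<Sum>j<k. \<Sum>d<l. (hnorm H (f d j))\<^sup>2)"
      by (rule sum_mono) simp
    then show "(\<Sum>j<k. \<Sum>c<l. (hnorm H (w c j))\<^sup>2) \<le> Y"
      unfolding Y_def by (subst sum.swap)
  qed (auto intro!: sum_nonneg simp: X_def)
  finally have le: "X \<le> sqrt X * sqrt Y" .
  have nonneg: "X \<ge> 0" "Y \<ge> 0"
    by (auto simp: X_def Y_def intro!: sum_nonneg)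
  have "X \<le> Y"
  proof (cases "X = 0")
    case False
    have "sqrt X * sqrt X \<le> sqrt X * sqrt Y"
      using le nonneg by simp
    then have "sqrt X \<le> sqrt Y"
      by (rule mult_left_le_imp_le) (use False nonneg in simp)
    then show ?thesis
      by simp
  qed (use nonneg in simp)
  then show ?thesis
    by (simp add: X_def Y_def u_def)
qed

lemma op_matrix_norm_mult_right_le_1:
  assumes T: "\<And>c d. c < l \<Longrightarrow> d < l \<Longrightarrow> T c d \<in> HAN H"
    and le: "op_matrix_norm H (conj_space H) l T \<le> 1"
    and A: "contractive_matrix H k (\<lambda>i j. A j i)" and k: "0 < k"
  shows "op_matrix_norm H (conj_space H) (l * k)
           (\<lambda>p q. mult_right H (T (p div k) (q div k)) (A (p mod k) (q mod k))) \<le> 1"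
  unfolding op_matrix_norm_def
proof (rule Sup_least, clarify)
  fix f assume f: "\<forall>j<l * k. f j \<in> carr H" and f1: "(\<Sum>j<l * k. (hnorm H (f j))\<^sup>2) \<le> 1"
  have idx: "d * k + j < l * k" if "d < l" "j < k" for d j
    using that by (metis add.commute mult.commute mult_le_mono2 mult_Suc_right nat_add_left_cancel_less less_le_trans Suc_leI)
  define F where "F d j = f (d * k + j)" for d j
  have F: "F d j \<in> carr H" if "d < l" "j < k" for d j
    using f idx that by (simp add: F_def)
  have fF: "f q = F (q div k) (q mod k)" for q
    by (simp add: F_def)
  define R where "R c i d j = mult_right H (T c d) (A i j) (F d j)" for c i d j
  have R: "R c i d j = T c d (\<lambda>x. A i j x * F d j x)" if "d < l" "j < k" for c i d j
    using F that by (simp add: R_def mult_right_def)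
  have row: "cnj_fun (\<lambda>x. \<Sum>q<l * k. R c i (q div k) (q mod k) x)
      = (\<lambda>x. \<Sum>d<l. \<Sum>j<k. cnj_fun (T c d (\<lambda>x. A i j x * F d j x)) x)" for c i
  proof
    fix x
    have "(\<Sum>q<l * k. R c i (q div k) (q mod k) x) = (\<Sum>d<l. \<Sum>j<k. R c i d j x)"
      by (rule sum_div_mod[OF k])
    also have "\<dots> = (\<Sum>d<l. \<Sum>j<k. T c d (\<lambda>x. A i j x * F d j x) x)"
      by (intro sum.cong refl) (auto simp: R)
    finally show "cnj_fun (\<lambda>x. \<Sum>q<l * k. R c i (q div k) (q mod k) x) x
      = (\<Sum>d<l. \<Sum>j<k. cnj_fun (T c d (\<lambda>x. A i j x * F d j x)) x)"
      by (simp add: cnj_fun_def flip: cnj_sum)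
  qed
  have "(\<Sum>p<l * k. (hnorm (conj_space H)
        (\<lambda>x. \<Sum>q<l * k. mult_right H (T (p div k) (q div k)) (A (p mod k) (q mod k)) (f q) x))\<^sup>2)
      = (\<Sum>p<l * k. (hnorm H (cnj_fun (\<lambda>x. \<Sum>q<l * k. R (p div k) (p mod k) (q div k) (q mod k) x)))\<^sup>2)"
    by (simp only: R_def fF[symmetric] hnorm_conj_space)
  also have "\<dots> = (\<Sum>c<l. \<Sum>i<k. (hnorm H (cnj_fun (\<lambda>x. \<Sum>q<l * k. R c i (q div k) (q mod k) x)))\<^sup>2)"
    by (rule sum_div_mod[OF k])
  also have "\<dots> \<le> (\<Sum>d<l. \<Sum>j<k. (hnorm H (F d j))\<^sup>2)"
    unfolding row by (rule hankel_matrix_bound[OF T le A F])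
  also have "\<dots> = (\<Sum>q<l * k. (hnorm H (F (q div k) (q mod k)))\<^sup>2)"
    by (rule sum_div_mod[OF k, symmetric])
  also have "\<dots> \<le> 1"
    using f1 by (simp only: fF[symmetric])
  finally show "ennreal (sqrt (\<Sum>p<l * k. (hnorm (conj_space H)
        (\<lambda>x. \<Sum>q<l * k. mult_right H (T (p div k) (q div k)) (A (p mod k) (q mod k)) (f q) x))\<^sup>2)) \<le> 1"
    by (simp add: ennreal_le_1)
qed

text \<open>Both matrix norms are dual norms. Pairing \<open>A h\<close> with a contractive matrix
  \<open>T\<close> over \<open>HAN0\<close> is, up to order of indices, pairing \<open>h\<close>
  with the matrix \<open>S\<close> of the operators \<open>T\<close> followed on the right by
  entries of \<open>A\<close>. As \<open>S\<close> is again contractive, the bound on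
  \<open>h\<close> applies to it.\<close>

lemma mult_weak_product_norm_le_1:
  assumes A: "contractive_matrix H k (\<lambda>i j. A j i)" and k: "0 < k"
  shows "os_norm (mult_weak_product_os H) k A \<le> 1"
  unfolding mult_weak_product_os_def op_space.simps cb_norm_def
proof (rule Sup_least, clarify)
  fix m :: nat and h :: "nat \<Rightarrow> nat \<Rightarrow> 'x \<Rightarrow> complex"
  assume m: "0 < m" and h: "\<forall>i<m. \<forall>j<m. h i j \<in> os_carrier (weak_product_os H)"
    and h1: "os_norm (weak_product_os H) m h \<le> 1"
  have h_mem: "h i j \<in> weak_product H" if "i < m" "j < m" for i j
    using h that by (simp add: weak_product_os_def)
  have contr: "contractive_multiplier H (A i j)" if "i < k" "j < k" for i j
    using contractive_matrix_entry[OF A that(2,1)] .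
  show "os_norm (weak_product_os H) (m * k)
          (\<lambda>p q x. A (p mod k) (q mod k) x * h (p div k) (q div k) x) \<le> 1"
    unfolding weak_product_os_def op_space.simps cb_norm_def
  proof (rule Sup_least, clarify)
    fix l :: nat and T :: "nat \<Rightarrow> nat \<Rightarrow> ('x \<Rightarrow> complex) \<Rightarrow> ('x \<Rightarrow> complex)"
    assume l: "0 < l" and T: "\<forall>i<l. \<forall>j<l. T i j \<in> os_carrier (HAN0_os H)"
      and T1: "os_norm (HAN0_os H) l T \<le> 1"
    have T0: "T c d \<in> HAN0 H" if "c < l" "d < l" for c d
      using T that by (simp add: HAN0_os_def)
    then have THAN: "T c d \<in> HAN H" if "c < l" "d < l" for c d
      using that by (simp add: HAN0_def)
    define S where "S p q = mult_right H (T (p div k) (q div k)) (A (p mod k) (q mod k))" for p q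
    have "S p q \<in> HAN0 H" if "p < l * k" "q < l * k" for p q
      unfolding S_def using that k by (intro mult_right_HAN0 contr T0) (auto simp: less_mult_imp_div_less)
    moreover have "op_matrix_norm H (conj_space H) (l * k) S \<le> 1"
      unfolding S_def using T1 by (intro op_matrix_norm_mult_right_le_1 THAN A k) (auto simp: HAN0_os_def)
    \<comment> \<open>The supremum defining the norm of \<open>h\<close> ranges over all sizes, so
      it may be tested on \<open>S\<close> at size \<open>l * k\<close>.\<close>
    ultimately have S: "complex_matrix_norm (l * k * m)
        (\<lambda>p q. hankel_pairing H (h (p mod m) (q mod m)) (S (p div m) (q div m))) \<le> 1"
      using k l
      by (intro order_trans[OF Sup_upper h1[unfolded weak_product_os_def op_space.simps cb_norm_def]])
        (auto simp: HAN0_os_def complex_os_def intro!: exI[of _ "l * k"] exI[of _ S])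
    have pq: "p div (m * k) < l" "p mod k < k" "p mod (m * k) div k < m" if "p < l * (m * k)" for p
      using that m k by (auto simp: less_mult_imp_div_less)
    have "complex_matrix_norm (l * (m * k)) (\<lambda>p q. hankel_pairing H
        (\<lambda>x. A (p mod (m * k) mod k) (q mod (m * k) mod k) x * h (p mod (m * k) div k) (q mod (m * k) div k) x)
        (T (p div (m * k)) (q div (m * k))))
      = complex_matrix_norm (l * (m * k)) (\<lambda>p q. (\<lambda>p q. hankel_pairing H (h (p mod m) (q mod m)) (S (p div m) (q div m)))
          (swap_index m k p) (swap_index m k q))"
      by (rule complex_matrix_norm_cong)
        (simp add: S_def swap_index_mod swap_index_div_div swap_index_div_mod m k pq mod_mod_cancel
          hankel_pairing_mult_right contr THAN h_mem)
    also have "\<dots> \<le> complex_matrix_norm (l * (m * k))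
        (\<lambda>p q. hankel_pairing H (h (p mod m) (q mod m)) (S (p div m) (q div m)))"
      by (rule complex_matrix_norm_permute[OF bij_swap_index[OF m k]])
    also have "\<dots> \<le> 1"
      using S by (simp add: mult_ac)
    finally show "os_norm complex_os (l * (m * k)) (\<lambda>p q. hankel_pairing H
        (\<lambda>x. A (p mod (m * k) mod k) (q mod (m * k) mod k) x * h (p mod (m * k) div k) (q mod (m * k) div k) x)
        (T (p div (m * k)) (q div (m * k)))) \<le> 1"
      by (simp add: complex_os_def)
  qed
qed

end

section \<open>From a completely bounded inverse to a uniform column bound\<close>

text \<open>An \<open>op_space\<close> only norms square matrices, so the row is described directly
  and padded by zeros when a matrix is required. The first clause makes each entry a multiplier of
  \<open>H\<close>.\<close>

definition row_contraction :: "'x fspace \<Rightarrow> nat \<Rightarrow> (nat \<Rightarrow> 'x \<Rightarrow> complex) \<Rightarrow> bool" where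
  "row_contraction H k \<phi> \<longleftrightarrow>
     (\<forall>i<k. vanishes_off (pts H) (\<phi> i) \<and> (\<forall>f\<in>carr H. (\<lambda>x. \<phi> i x * f x) \<in> carr H)) \<and>
     (\<forall>g. (\<forall>i<k. g i \<in> carr H) \<longrightarrow>
        (hnorm H (\<lambda>x. \<Sum>i<k. \<phi> i x * g i x))\<^sup>2 \<le> (\<Sum>i<k. (hnorm H (g i))\<^sup>2))"

context semi_inner_fspace
begin

text \<open>Put the row into column 0 of a square matrix. Its transpose is contractive over
  \<open>Mult(H)\<close>, so it lies in the unit ball over the multipliers of the weak product. The
  inverse fixes its entries and is completely bounded, so the column has norm at most
  \<open>C\<close> over \<open>Mult(H)\<close>, independently of \<open>k\<close>; test it on
  \<open>f\<close> placed in slot 0.\<close>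

lemma cb_inverse_bounds_columns:
  assumes "has_cb_inverse (mult_os H) (mult_weak_product_os H) mult_inclusion"
  shows "\<exists>C. \<forall>k \<phi> f. row_contraction H k \<phi> \<and> f \<in> carr H \<and> hnorm H f \<le> 1 \<longrightarrow>
           (\<Sum>i<k. (hnorm H (\<lambda>x. \<phi> i x * f x))\<^sup>2) \<le> C"
proof -
  obtain R where R: "\<And>v. v \<in> multipliers (pts H) (carr H) \<Longrightarrow> R v = v"
    and cb: "completely_bounded (mult_weak_product_os H) (mult_os H) R"
    using assms by (auto simp: has_cb_inverse_def mult_inclusion_def mult_os_def)
  define N where "N = cb_norm (mult_weak_product_os H) (mult_os H) 1 (\<lambda>v i j. R v)"
  have "N < \<infinity>" using cb by (simp add: completely_bounded_def N_def)
  then obtain C where C: "N = ennreal C" "C \<ge> 0" by (cases N) auto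
  show ?thesis
  proof (rule exI[of _ "C\<^sup>2"], clarify)
    fix k \<phi> f
    assume row: "row_contraction H k \<phi>" and f: "f \<in> carr H" "hnorm H f \<le> 1"
    show "(\<Sum>i<k. (hnorm H (\<lambda>x. \<phi> i x * f x))\<^sup>2) \<le> C\<^sup>2"
    proof (cases "k = 0")
      case False
      then have k: "0 < k" by simp
      \<comment> \<open>The guard \<open>i < k\<close> makes every entry a multiplier, even beyond
        the relevant indices, so that \<open>R\<close> can be rewritten away under the index
        binders.\<close>
      define A where "A i j = (if j = (0::nat) \<and> i < k then \<phi> i else (\<lambda>x. 0))" for i j
      have A_mult: "A i j \<in> multipliers (pts H) (carr H)" for i j
        using row zero_mem
        by (auto simp: A_def row_contraction_def multipliers_def vanishes_off_def)
      have contr: "contractive_matrix H k (\<lambda>i j. A j i)"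
        unfolding contractive_matrix_def
      proof (intro conjI allI impI ballI)
        show "(\<lambda>x. A j i x * f x) \<in> carr H" if "f \<in> carr H" for i j f
          using A_mult that by (simp add: multipliers_def)
        fix g :: "nat \<Rightarrow> 'x \<Rightarrow> complex" assume g: "\<forall>j<k. g j \<in> carr H"
        have "(\<lambda>x. \<Sum>j<k. A j i x * g j x) = (if i = 0 then (\<lambda>x. \<Sum>j<k. \<phi> j x * g j x) else (\<lambda>x. 0))" for i
          by (auto simp: A_def)
        then have "(\<Sum>i<k. (hnorm H (\<lambda>x. \<Sum>j<k. A j i x * g j x))\<^sup>2)
            = (\<Sum>i<k. if i = 0 then (hnorm H (\<lambda>x. \<Sum>j<k. \<phi> j x * g j x))\<^sup>2 else 0)"
          by (intro sum.cong) (auto simp: hnorm_zero)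
        also have "\<dots> = (hnorm H (\<lambda>x. \<Sum>j<k. \<phi> j x * g j x))\<^sup>2"
          using k by simp
        also have "\<dots> \<le> (\<Sum>i<k. (hnorm H (g i))\<^sup>2)"
          using row g by (simp add: row_contraction_def)
        finally show "(\<Sum>i<k. (hnorm H (\<lambda>x. \<Sum>j<k. A j i x * g j x))\<^sup>2) \<le> (\<Sum>i<k. (hnorm H (g i))\<^sup>2)" .
      qed
      have "A i j \<in> multipliers (pts H) (weak_product H)" if "i < k" "j < k" for i j
        using contractive_matrix_entry[OF contr that(2,1)] weak_product_mult A_mult[of i j]
        by (auto simp: multipliers_def)
      then have "os_norm (mult_os H) (k * 1) (\<lambda>p q. R (A (p div 1) (q div 1))) \<le> N"
        unfolding N_def cb_norm_def
        using k mult_weak_product_norm_le_1[OF contr k]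
        by (intro Sup_upper) (auto simp: mult_weak_product_os_def intro!: exI[of _ k] exI[of _ A])
      then have le: "op_matrix_norm H H k (\<lambda>i j f x. A i j x * f x) \<le> N"
        by (simp add: mult_os_def R[OF A_mult])
      define F where "F j = (if j = (0::nat) then f else (\<lambda>x. 0))" for j
      have "(\<Sum>j<k. (hnorm H (F j))\<^sup>2) = (\<Sum>j<k. if j = 0 then (hnorm H f)\<^sup>2 else 0)"
        by (intro sum.cong) (auto simp: F_def hnorm_zero)
      also have "\<dots> \<le> 1"
        using k f hnorm_nonneg[of f] by (simp add: power_le_one)
      finally have F1: "(\<Sum>j<k. (hnorm H (F j))\<^sup>2) \<le> 1" .
      have F: "\<forall>j<k. F j \<in> carr H"
        using f zero_mem by (simp add: F_def)
      have "ennreal (sqrt (\<Sum>i<k. (hnorm H (\<lambda>x. \<Sum>j<k. A i j x * F j x))\<^sup>2)) \<le> N"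
        using F F1 by (intro order_trans[OF Sup_upper le[unfolded op_matrix_norm_def]]) auto
      moreover have "(\<lambda>x. \<Sum>j<k. A i j x * F j x) = (\<lambda>x. \<phi> i x * f x)" if "i < k" for i
      proof
        fix x
        have "(\<Sum>j<k. A i j x * F j x) = (\<Sum>j<k. if j = 0 then \<phi> i x * f x else 0)"
          using that by (intro sum.cong) (auto simp: A_def F_def)
        then show "(\<Sum>j<k. A i j x * F j x) = \<phi> i x * f x"
          using k by simp
      qed
      ultimately have "sqrt (\<Sum>i<k. (hnorm H (\<lambda>x. \<phi> i x * f x))\<^sup>2) \<le> C"
        by (simp add: C ennreal_le_iff)
      then show ?thesis
        using real_le_rsqrt sqrt_le_D by blast
    qed simp
  qed
qed

end

section \<open>Reproducing kernels\<close>

locale reproducing_kernel_space =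
  fixes X :: "'x set" and K :: "'x \<Rightarrow> 'x \<Rightarrow> complex" and H :: "'x fspace"
  assumes rkhs: "rkhs_with_kernel X K H"
begin

sublocale semi_inner_fspace H
  using rkhs unfolding rkhs_with_kernel_def hilbert_fspace_def by unfold_locales blast+

definition kernel_fun :: "'x \<Rightarrow> 'x \<Rightarrow> complex" where
  "kernel_fun w = (\<lambda>z. if z \<in> X then K z w else 0)"

text \<open>The adjoint of multiplication by \<open>\<phi>\<close> only changes the coefficients
  \<open>a w\<close> into \<open>a w * cnj (\<phi> w)\<close>. Thus adjoints can be handled
  explicitly on these vectors.\<close>

definition kernel_comb :: "'x set \<Rightarrow> ('x \<Rightarrow> complex) \<Rightarrow> 'x \<Rightarrow> complex" where
  "kernel_comb S a = (\<lambda>x. \<Sum>w\<in>S. a w * kernel_fun w x)"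

lemma kernel_fun_mem: "w \<in> X \<Longrightarrow> kernel_fun w \<in> carr H"
  and reproducing: "f \<in> carr H \<Longrightarrow> w \<in> X \<Longrightarrow> ip H f (kernel_fun w) = f w"
  and vanishes: "f \<in> carr H \<Longrightarrow> x \<notin> X \<Longrightarrow> f x = 0"
  and pts_eq: "pts H = X"
  using rkhs unfolding rkhs_with_kernel_def hilbert_fspace_def vanishes_off_def kernel_fun_def by blast+

lemma ip_kernel_fun_left: "f \<in> carr H \<Longrightarrow> w \<in> X \<Longrightarrow> ip H (kernel_fun w) f = cnj (f w)"
  using reproducing ip_cnj kernel_fun_mem by metis

lemma kernel_comb_mem: "S \<subseteq> X \<Longrightarrow> kernel_comb S a \<in> carr H"
  unfolding kernel_comb_def by (intro sum_mem scale_mem kernel_fun_mem) auto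

lemma ip_kernel_comb_left:
  assumes "S \<subseteq> X" "f \<in> carr H"
  shows "ip H (kernel_comb S a) f = (\<Sum>w\<in>S. a w * cnj (f w))"
proof -
  have "ip H (kernel_comb S a) f = (\<Sum>w\<in>S. ip H (\<lambda>x. a w * kernel_fun w x) f)"
    unfolding kernel_comb_def by (rule ip_sum_left) (use assms in \<open>auto intro: scale_mem kernel_fun_mem\<close>)
  also have "\<dots> = (\<Sum>w\<in>S. a w * cnj (f w))"
    using assms by (intro sum.cong refl) (auto simp: ip_scale_left kernel_fun_mem ip_kernel_fun_left)
  finally show ?thesis .
qed

lemma hnorm_kernel_comb:
  assumes "S \<subseteq> X"
  shows "(hnorm H (kernel_comb S a))\<^sup>2 = Re (\<Sum>w\<in>S. \<Sum>v\<in>S. a w * cnj (a v) * cnj (K w v))"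
proof -
  have "ip H (kernel_comb S a) (kernel_comb S a) = (\<Sum>w\<in>S. a w * cnj (kernel_comb S a w))"
    using assms by (intro ip_kernel_comb_left kernel_comb_mem)
  also have "\<dots> = (\<Sum>w\<in>S. \<Sum>v\<in>S. a w * cnj (a v) * cnj (K w v))"
    using assms by (intro sum.cong refl)
      (auto simp: kernel_comb_def kernel_fun_def sum_distrib_left mult_ac intro!: sum.cong)
  finally show ?thesis
    using assms by (simp add: hnorm_sq kernel_comb_mem)
qed

text \<open>The rate is what the parallelogram law yields for vectors whose energy exceeds the
  infimum by less than \<open>1 / (n + 1)\<close>.\<close>

lemma convergent_if_Cauchy:
  assumes "\<And>n. v n \<in> carr H"
    and "\<And>m n :: nat. (hnorm H (\<lambda>x. v m x - v n x))\<^sup>2 \<le> 2 / (real m + 1) + 2 / (real n + 1)"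
  obtains f where "f \<in> carr H" "(\<lambda>n. hnorm H (\<lambda>x. v n x - f x)) \<longlonglongrightarrow> 0"
proof -
  have "\<exists>N. \<forall>m\<ge>N. \<forall>n\<ge>N. hnorm H (\<lambda>x. v m x - v n x) < e" if "e > 0" for e
  proof -
    obtain N :: nat where N: "4 / e\<^sup>2 < real N"
      using reals_Archimedean2 by blast
    have "hnorm H (\<lambda>x. v m x - v n x) < e" if "m \<ge> N" "n \<ge> N" for m n
    proof -
      have "N > 0" using N \<open>e > 0\<close> by (cases N) (auto simp: divide_simps)
      have "2 / (real m + 1) \<le> 2 / (real N + 1)" "2 / (real n + 1) \<le> 2 / (real N + 1)"
        using that by (auto intro!: divide_left_mono)
      then have "(hnorm H (\<lambda>x. v m x - v n x))\<^sup>2 \<le> 4 / (real N + 1)"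
        using assms(2)[of m n] by simp
      also have "\<dots> < e\<^sup>2"
        using N \<open>e > 0\<close> by (simp add: field_simps) (smt (verit) zero_less_power)
      finally show ?thesis
        using \<open>e > 0\<close> by (intro power_less_imp_less_base[of _ 2 e]) auto
    qed
    then show ?thesis by blast
  qed
  then have "\<exists>f\<in>carr H. (\<lambda>n. hnorm H (\<lambda>x. v n x - f x)) \<longlonglongrightarrow> 0"
    using assms(1) rkhs unfolding rkhs_with_kernel_def hilbert_fspace_def by blast
  then show ?thesis using that by blast
qed

text \<open>Riesz representation of the functional with graph \<open>G\<close>: the representing vector minimises
  \<open>\<parallel>v\<parallel>\<^sup>2 - 2 Re s\<close> over \<open>(v, s) \<in> G\<close>.\<close>

lemma riesz_graph:
  assumes F: "\<And>x. x \<notin> X \<Longrightarrow> F x = 0"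
    and G: "\<And>v s. (v, s) \<in> G \<Longrightarrow> v \<in> carr H"
    and G_comb: "\<And>v s v' s' b b'. (v, s) \<in> G \<Longrightarrow> (v', s') \<in> G \<Longrightarrow>
                  (\<lambda>x. b * v x + b' * v' x, b * s + b' * s') \<in> G"
    and G_kernel: "\<And>w. w \<in> X \<Longrightarrow> (kernel_fun w, cnj (F w)) \<in> G"
    and G_le: "\<And>v s. (v, s) \<in> G \<Longrightarrow> cmod s \<le> c * hnorm H v"
    and G_ne: "G \<noteq> {}"
  shows "F \<in> carr H \<and> (\<exists>v s. (\<forall>n. (v n, s n) \<in> G) \<and> (\<lambda>n. hnorm H (\<lambda>x. v n x - F x)) \<longlonglongrightarrow> 0)"
proof -
  define J where "J p = (hnorm H (fst p))\<^sup>2 - 2 * Re (snd p)" for p :: "('x \<Rightarrow> complex) \<times> complex"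
  define m where "m = Inf (J ` G)"
  \<comment> \<open>Complete the square in the norm of \<open>v\<close>: the energy is at least
    \<open>|v|^2 - 2 c |v|\<close>, hence bounded below.\<close>
  have J_ge: "J p \<ge> - c\<^sup>2" if "p \<in> G" for p
  proof -
    have "Re (snd p) \<le> c * hnorm H (fst p)"
      using G_le[of "fst p" "snd p"] that complex_Re_le_cmod order_trans by fastforce
    moreover have "0 \<le> (hnorm H (fst p) - c)\<^sup>2" by simp
    ultimately show ?thesis
      by (simp add: J_def power2_diff algebra_simps)
  qed
  then have "bdd_below (J ` G)" by (auto intro!: bdd_belowI)
  then have m: "m \<le> J p" if "p \<in> G" for p
    unfolding m_def using that by (intro cInf_lower) auto
  have "\<exists>p\<in>G. J p < m + 1 / (real n + 1)" for n
  proof -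
    have "Inf (J ` G) < m + 1 / (real n + 1)" by (simp add: m_def)
    then obtain y where "y \<in> J ` G" "y < m + 1 / (real n + 1)"
      using cInf_lessD[of "J ` G"] G_ne by blast
    then show ?thesis by blast
  qed
  then obtain p where p: "\<And>n. p n \<in> G" "\<And>n. J (p n) < m + 1 / (real n + 1)" by metis
  define v where "v n = fst (p n)" for n
  define s where "s n = snd (p n)" for n
  have vs: "(v n, s n) \<in> G" for n using p by (simp add: v_def s_def)
  have Jn: "(hnorm H (v n))\<^sup>2 - 2 * Re (s n) < m + 1 / (real n + 1)" for n
    using p by (simp add: J_def v_def s_def)
  have v_mem: "v n \<in> carr H" for n using G vs by blast
  have Cauchy: "(hnorm H (\<lambda>x. v i x - v j x))\<^sup>2 \<le> 2 / (real i + 1) + 2 / (real j + 1)" for i j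
  proof -
    \<comment> \<open>The midpoint of two near-minimisers is again in the graph, so its energy is at
      least \<open>m\<close>; the parallelogram law then bounds the distance of the two.\<close>
    have "m \<le> J (\<lambda>x. 1/2 * v i x + 1/2 * v j x, 1/2 * s i + 1/2 * s j)"
      by (intro m G_comb vs)
    moreover have "(\<lambda>x. 1/2 * v i x + 1/2 * v j x) = (\<lambda>x. 1/2 * (v i x + v j x))"
      by (simp add: algebra_simps)
    then have "hnorm H (\<lambda>x. 1/2 * v i x + 1/2 * v j x) = 1/2 * hnorm H (\<lambda>x. v i x + v j x)"
      using hnorm_scale[OF add_mem[OF v_mem v_mem], of "1/2"] by simp
    ultimately have "m \<le> (1/2 * hnorm H (\<lambda>x. v i x + v j x))\<^sup>2 - 2 * Re (1/2 * s i + 1/2 * s j)"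
      by (simp only: J_def fst_conv snd_conv)
    then have "4 * m \<le> (hnorm H (\<lambda>x. v i x + v j x))\<^sup>2 - 4 * Re (s i) - 4 * Re (s j)"
      by (simp add: power_divide)
    moreover have two_div: "2 / (real k + 1) = 2 * (1 / (real k + 1))" for k
      by simp
    ultimately show ?thesis
      using hnorm_sq_add[OF v_mem v_mem, of i j] hnorm_sq_diff[OF v_mem v_mem, of i j] Jn[of i] Jn[of j]
        two_div[of i] two_div[of j] by linarith
  qed
  obtain f where f: "f \<in> carr H" and lim: "(\<lambda>n. hnorm H (\<lambda>x. v n x - f x)) \<longlonglongrightarrow> 0"
    by (rule convergent_if_Cauchy[of v]) (use v_mem Cauchy in auto)
  have "f w = F w" for w
  proof (cases "w \<in> X")
    case True
    define \<kappa> where "\<kappa> = (hnorm H (kernel_fun w))\<^sup>2"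
    have "\<kappa> \<ge> 0" by (simp add: \<kappa>_def)
    have "(cmod (v n w - F w))\<^sup>2 \<le> (\<kappa> + 1) / (real n + 1)" for n
    proof -
      define D where "D = v n w - F w"
      \<comment> \<open>Perturbing \<open>v n\<close> by a multiple of the kernel function in the
        direction \<open>- D\<close> must not lower the energy below \<open>m\<close>. The best step
        would be \<open>1 / \<kappa>\<close>; adding 1 keeps it defined when
        \<open>\<kappa> = 0\<close> and still yields
        \<open>\<epsilon> * |D|^2 <= 1 / (n + 1)\<close>.\<close>
      define \<epsilon> where "\<epsilon> = 1 / (\<kappa> + 1)"
      define t where "t = - (of_real \<epsilon> * D)"
      have "\<epsilon> > 0" using \<open>\<kappa> \<ge> 0\<close> by (simp add: \<epsilon>_def)
      have "m \<le> J (\<lambda>x. 1 * v n x + t * kernel_fun w x, 1 * s n + t * cnj (F w))"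
        by (intro m G_comb vs G_kernel True)
      also have "\<dots> = (hnorm H (v n))\<^sup>2 - 2 * Re (s n) + 2 * Re (cnj t * v n w) - 2 * Re (t * cnj (F w)) + (cmod t)\<^sup>2 * \<kappa>"
        using hnorm_sq_add[OF v_mem scale_mem[OF kernel_fun_mem[OF True]], of n t]
          reproducing[OF v_mem True, of n]
        by (simp add: J_def ip_scale_right v_mem kernel_fun_mem True hnorm_scale power_mult_distrib \<kappa>_def)
      finally have "m \<le> (hnorm H (v n))\<^sup>2 - 2 * Re (s n) + 2 * Re (cnj t * v n w) - 2 * Re (t * cnj (F w))
          + (cmod t)\<^sup>2 * \<kappa>" .
      moreover have "Re (cnj t * v n w) - Re (t * cnj (F w)) = Re (cnj t * D)"
        by (simp add: D_def algebra_simps)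
      moreover have "Re (cnj t * D) = - (\<epsilon> * (cmod D)\<^sup>2)"
        by (simp add: t_def cmod_power2) (simp add: power2_eq_square algebra_simps)
      moreover have "(cmod t)\<^sup>2 * \<kappa> = \<epsilon>\<^sup>2 * (cmod D)\<^sup>2 * \<kappa>"
        using \<open>\<epsilon> > 0\<close> by (simp add: t_def norm_mult power_mult_distrib)
      ultimately have "0 \<le> 1 / (real n + 1) - 2 * (\<epsilon> * (cmod D)\<^sup>2) + \<epsilon>\<^sup>2 * (cmod D)\<^sup>2 * \<kappa>"
        using Jn[of n] by linarith
      then have "(2 * \<epsilon> - \<epsilon>\<^sup>2 * \<kappa>) * (cmod D)\<^sup>2 \<le> 1 / (real n + 1)"
        by (simp add: algebra_simps)
      moreover have "\<epsilon> * (cmod D)\<^sup>2 \<le> (2 * \<epsilon> - \<epsilon>\<^sup>2 * \<kappa>) * (cmod D)\<^sup>2"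
      proof (rule mult_right_mono)
        have "\<epsilon> * \<kappa> \<le> 1" using \<open>\<kappa> \<ge> 0\<close> by (simp add: \<epsilon>_def)
        then have "\<epsilon> * (\<epsilon> * \<kappa>) \<le> \<epsilon>" using \<open>\<epsilon> > 0\<close> by (simp add: mult_le_cancel_left1)
        then show "\<epsilon> \<le> 2 * \<epsilon> - \<epsilon>\<^sup>2 * \<kappa>" by (simp add: power2_eq_square mult.assoc)
      qed simp
      ultimately have "\<epsilon> * (cmod D)\<^sup>2 \<le> 1 / (real n + 1)" by simp
      then show ?thesis
        using \<open>\<kappa> \<ge> 0\<close> by (simp add: \<epsilon>_def D_def field_simps)
    qed
    moreover have "(\<lambda>n. (\<kappa> + 1) / (real n + 1)) \<longlonglongrightarrow> 0"
      by real_asymp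
    ultimately have "(\<lambda>n. (cmod (v n w - F w))\<^sup>2) \<longlonglongrightarrow> 0"
      using Lim_null_comparison[of "\<lambda>n. (cmod (v n w - F w))\<^sup>2" "\<lambda>n. (\<kappa> + 1) / (real n + 1)" sequentially]
      by simp
    then have "(\<lambda>n. sqrt ((cmod (v n w - F w))\<^sup>2)) \<longlonglongrightarrow> sqrt 0"
      by (rule tendsto_real_sqrt)
    then have 1: "(\<lambda>n. v n w) \<longlonglongrightarrow> F w"
      by (simp add: tendsto_norm_zero_iff LIM_zero_iff)
    \<comment> \<open>Norm convergence forces pointwise convergence by the reproducing property, so
      the limit \<open>f\<close> has the same values as \<open>F\<close>.\<close>
    have "cmod (v n w - f w) \<le> hnorm H (\<lambda>x. v n x - f x) * hnorm H (kernel_fun w)" for n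
      using Cauchy_Schwarz[OF diff_mem[OF v_mem f] kernel_fun_mem[OF True], of n]
        reproducing[OF diff_mem[OF v_mem f] True, of n] by simp
    moreover have "(\<lambda>n. hnorm H (\<lambda>x. v n x - f x) * hnorm H (kernel_fun w)) \<longlonglongrightarrow> 0"
      using tendsto_mult_right[OF lim, of "hnorm H (kernel_fun w)"] by simp
    ultimately have "(\<lambda>n. v n w - f w) \<longlonglongrightarrow> 0"
      using Lim_null_comparison[of "\<lambda>n. v n w - f w" "\<lambda>n. hnorm H (\<lambda>x. v n x - f x) * hnorm H (kernel_fun w)" sequentially]
      by simp
    then have "(\<lambda>n. v n w) \<longlonglongrightarrow> f w"
      by (simp add: LIM_zero_iff)
    then show ?thesis
      using 1 LIMSEQ_unique by blast
  qed (simp add: F vanishes[OF f])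
  then have "f = F" by blast
  then show ?thesis using f lim vs by blast
qed

text \<open>The hypothesis says that the would-be inner product with \<open>F\<close> is a
  functional of norm at most \<open>c\<close> on kernel combinations; Riesz representation produces
  \<open>F\<close> itself, since the functional takes the value \<open>cnj (F w)\<close> at the
  kernel function of \<open>w\<close>.\<close>

lemma dominated_mem:
  assumes F: "\<And>x. x \<notin> X \<Longrightarrow> F x = 0" and c: "0 \<le> c"
    and le: "\<And>S a. finite S \<Longrightarrow> S \<subseteq> X \<Longrightarrow>
               cmod (\<Sum>w\<in>S. a w * cnj (F w)) \<le> c * hnorm H (kernel_comb S a)"
  shows "F \<in> carr H" and "hnorm H F \<le> c"
proof -
  \<comment> \<open>A graph rather than a function: kernel functions may be linearly dependent, so a
    combination need not determine its coefficients.\<close>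
  define G where "G = {(kernel_comb S a, \<Sum>w\<in>S. a w * cnj (F w)) | S a. finite S \<and> S \<subseteq> X}"
  have comb: "(\<lambda>x. b * v x + b' * v' x, b * s + b' * s') \<in> G"
    if vs: "(v, s) \<in> G" "(v', s') \<in> G" for v s v' s' b b'
  proof -
    obtain S a where S: "finite S" "S \<subseteq> X" "v = kernel_comb S a" "s = (\<Sum>w\<in>S. a w * cnj (F w))"
      using vs by (auto simp: G_def)
    obtain S' a' where S': "finite S'" "S' \<subseteq> X" "v' = kernel_comb S' a'" "s' = (\<Sum>w\<in>S'. a' w * cnj (F w))"
      using vs by (auto simp: G_def)
    define e where "e w = b * (if w \<in> S then a w else 0) + b' * (if w \<in> S' then a' w else 0)" for w
    have sum: "(\<Sum>w\<in>S \<union> S'. e w * q w) = b * (\<Sum>w\<in>S. a w * q w) + b' * (\<Sum>w\<in>S'. a' w * q w)" for q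
    proof -
      have "(\<Sum>w\<in>S \<union> S'. (if w \<in> S then a w else 0) * q w) = (\<Sum>w\<in>S. a w * q w)"
        using S S' by (intro sum.mono_neutral_cong_right) auto
      moreover have "(\<Sum>w\<in>S \<union> S'. (if w \<in> S' then a' w else 0) * q w) = (\<Sum>w\<in>S'. a' w * q w)"
        using S S' by (intro sum.mono_neutral_cong_right) auto
      ultimately show ?thesis
        by (simp add: e_def distrib_right sum.distrib mult.assoc flip: sum_distrib_left)
    qed
    have "(\<lambda>x. b * v x + b' * v' x, b * s + b' * s')
        = (kernel_comb (S \<union> S') e, \<Sum>w\<in>S \<union> S'. e w * cnj (F w))"
      by (simp add: S S' sum kernel_comb_def)
    then show ?thesis
      using S S' by (auto simp: G_def)
  qed
  have kernel: "(kernel_fun w, cnj (F w)) \<in> G" if "w \<in> X" for w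
    using that by (auto simp: G_def kernel_comb_def intro!: exI[of _ "{w}"] exI[of _ "\<lambda>_. 1"])
  have G_mem: "v \<in> carr H" and G_le: "cmod s \<le> c * hnorm H v" if "(v, s) \<in> G" for v s
    using that le by (auto simp: G_def kernel_comb_mem)
  have "(kernel_comb {} (\<lambda>_. 0), 0) \<in> G"
    by (auto simp: G_def intro!: exI[of _ "{}"])
  then have "G \<noteq> {}" by blast
  have "F \<in> carr H \<and> (\<exists>v s. (\<forall>n. (v n, s n) \<in> G) \<and> (\<lambda>n. hnorm H (\<lambda>x. v n x - F x)) \<longlonglongrightarrow> 0)"
    by (rule riesz_graph[of F G c]) (erule F | erule G_mem | erule (1) comb | erule kernel | erule G_le | fact)+
  then obtain v s where F_mem: "F \<in> carr H" and vs: "\<And>n. (v n, s n) \<in> G"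
    and lim: "(\<lambda>n. hnorm H (\<lambda>x. v n x - F x)) \<longlonglongrightarrow> 0"
    by blast
  show "F \<in> carr H" by fact
  have v_mem: "v n \<in> carr H" for n
    using vs[of n] by (auto simp: G_def kernel_comb_mem)
  have ip_v: "ip H (v n) F = s n" for n
    using vs[of n] F_mem by (auto simp: G_def ip_kernel_comb_left)
  have s_le: "cmod (s n) \<le> c * hnorm H (v n)" for n
    using vs[of n] le by (auto simp: G_def)
  define d where "d n = hnorm H (\<lambda>x. v n x - F x)" for n
  \<comment> \<open>Approximate one argument of \<open>ip H F F\<close> by \<open>v n\<close>, where
    the functional is bounded by \<open>c\<close>; the limit is
    \<open>|F|^2 <= c |F|\<close>.\<close>
  have "(hnorm H F)\<^sup>2 \<le> d n * hnorm H F + c * (d n + hnorm H F)" for n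
  proof -
    have "complex_of_real ((hnorm H F)\<^sup>2) = s n - ip H (\<lambda>x. v n x - F x) F"
      using F_mem v_mem ip_self[OF F_mem] by (simp add: ip_diff_left ip_v)
    then have "(hnorm H F)\<^sup>2 \<le> cmod (s n) + cmod (ip H (\<lambda>x. v n x - F x) F)"
      by (metis norm_of_real abs_power2 norm_triangle_ineq4)
    also have "cmod (ip H (\<lambda>x. v n x - F x) F) \<le> d n * hnorm H F"
      unfolding d_def by (intro Cauchy_Schwarz diff_mem v_mem F_mem)
    also have "cmod (s n) \<le> c * (d n + hnorm H F)"
    proof -
      have "hnorm H (v n) \<le> d n + hnorm H F"
        using hnorm_triangle[OF diff_mem[OF v_mem F_mem] F_mem, of n] by (simp add: d_def)
      then show ?thesis
        using s_le[of n] c by (meson mult_left_mono order_trans)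
    qed
    finally show ?thesis by simp
  qed
  moreover have "(\<lambda>n. d n * hnorm H F + c * (d n + hnorm H F)) \<longlonglongrightarrow> 0 * hnorm H F + c * (0 + hnorm H F)"
    using lim unfolding d_def by (intro tendsto_intros)
  ultimately have "(hnorm H F)\<^sup>2 \<le> 0 * hnorm H F + c * (0 + hnorm H F)"
    by (intro LIMSEQ_le_const) auto
  then show "hnorm H F \<le> c"
    using c hnorm_nonneg[OF F_mem] by (cases "hnorm H F = 0") (auto simp: power2_eq_square)
qed

text \<open>\<open>pos\<close> says that the adjoint of the row is a contractive column on kernel
  combinations. Cauchy-Schwarz against \<open>g\<close> then gives the domination required by
  \<open>dominated_mem\<close>, which yields membership and the norm bound together.\<close>

lemma row_mult_mem:
  assumes pos: "\<And>S a. finite S \<Longrightarrow> S \<subseteq> X \<Longrightarrow>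
      (\<Sum>i<n. (hnorm H (kernel_comb S (\<lambda>w. a w * cnj (\<phi> i w))))\<^sup>2) \<le> (hnorm H (kernel_comb S a))\<^sup>2"
    and g: "\<And>i. i < n \<Longrightarrow> g i \<in> carr H"
  shows "(\<lambda>x. \<Sum>i<n. \<phi> i x * g i x) \<in> carr H"
    and "(hnorm H (\<lambda>x. \<Sum>i<n. \<phi> i x * g i x))\<^sup>2 \<le> (\<Sum>i<n. (hnorm H (g i))\<^sup>2)"
proof -
  let ?F = "\<lambda>x. \<Sum>i<n. \<phi> i x * g i x" and ?c = "sqrt (\<Sum>i<n. (hnorm H (g i))\<^sup>2)"
  have "cmod (\<Sum>w\<in>S. a w * cnj (?F w)) \<le> ?c * hnorm H (kernel_comb S a)"
    if S: "finite S" "S \<subseteq> X" for S a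
  proof -
    have "(\<Sum>w\<in>S. a w * cnj (?F w)) = (\<Sum>w\<in>S. \<Sum>i<n. a w * cnj (\<phi> i w) * cnj (g i w))"
      by (simp add: sum_distrib_left mult.assoc)
    also have "\<dots> = (\<Sum>i<n. \<Sum>w\<in>S. a w * cnj (\<phi> i w) * cnj (g i w))"
      by (rule sum.swap)
    also have "\<dots> = (\<Sum>i<n. ip H (kernel_comb S (\<lambda>w. a w * cnj (\<phi> i w))) (g i))"
      using S g by (intro sum.cong refl ip_kernel_comb_left[symmetric]) auto
    finally have "cmod (\<Sum>w\<in>S. a w * cnj (?F w))
        \<le> sqrt (\<Sum>i<n. (hnorm H (kernel_comb S (\<lambda>w. a w * cnj (\<phi> i w))))\<^sup>2) * ?c"
      using Cauchy_Schwarz_sum[of "{..<n}" "\<lambda>i. kernel_comb S (\<lambda>w. a w * cnj (\<phi> i w))" g]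
        S g kernel_comb_mem by simp
    also have "\<dots> \<le> hnorm H (kernel_comb S a) * ?c"
      using pos[OF S, of a] hnorm_nonneg[OF kernel_comb_mem[OF S(2)]]
      by (intro mult_right_mono real_le_lsqrt) (auto intro!: sum_nonneg)
    finally show ?thesis by (simp add: mult.commute)
  qed
  moreover have "?F x = 0" if "x \<notin> X" for x
    using that g vanishes by (intro sum.neutral) auto
  moreover have "0 \<le> ?c" by (simp add: sum_nonneg)
  ultimately have "?F \<in> carr H" "hnorm H ?F \<le> ?c"
    using dominated_mem[of ?F ?c] by blast+
  then show "?F \<in> carr H" "(hnorm H ?F)\<^sup>2 \<le> (\<Sum>i<n. (hnorm H (g i))\<^sup>2)"
    using sqrt_ge_absD hnorm_nonneg by fastforce+
qed

end

text \<open>Any convergent expansion near 0 determines the derivatives at 0; all Taylor coefficients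
  below are computed by exhibiting a series.\<close>

lemma taylor_coeff_unique:
  assumes "0 < r" and sums: "\<And>z. cmod z < r \<Longrightarrow> (\<lambda>n. a n * z ^ n) sums f z"
  shows "taylor_coeff f n = a n"
proof -
  have "ereal r \<le> conv_radius a"
  proof (rule conv_radius_geI_ex)
    fix r' assume "0 < r'" "ereal r' < ereal r"
    then have "summable (\<lambda>n. a n * of_real r' ^ n)"
      using sums[of "of_real r'"] by (auto simp: sums_iff)
    then show "\<exists>z. norm z = r' \<and> summable (\<lambda>n. a n * z ^ n)"
      using \<open>0 < r'\<close> by (intro exI[of _ "of_real r'"]) auto
  qed
  then have "fps_conv_radius (Abs_fps a) > 0"
    using \<open>0 < r\<close> by (simp add: fps_conv_radius_def) (metis ereal_less(2) less_le_trans)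
  moreover have "eventually (\<lambda>z. z \<in> ball 0 r) (nhds (0::complex))"
    using \<open>0 < r\<close> by (intro eventually_nhds_in_open) auto
  then have "eventually (\<lambda>z. eval_fps (Abs_fps a) z = f z) (nhds 0)"
    by eventually_elim (use sums in \<open>auto simp: eval_fps_def sums_iff\<close>)
  ultimately have "f has_fps_expansion Abs_fps a"
    by (simp add: has_fps_expansion_def)
  then show ?thesis
    using fps_nth_fps_expansion[of f "Abs_fps a" n] by (simp add: taylor_coeff_def)
qed

section \<open>The Drury--Arveson space\<close>

text \<open>Termwise \<open>|v w| <= (|v|^2 + |w|^2) / 2\<close> suffices: the half sum of two
  numbers below 1 is below 1.\<close>

lemma unit_ball_inner:
  assumes "v \<in> unit_ball d" "w \<in> unit_ball d"
  shows summable_unit_ball_inner: "summable (\<lambda>i. v i * cnj (w i))"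
    and unit_ball_inner_less_1: "cmod (\<Sum>i. v i * cnj (w i)) < 1"
proof -
  have sv: "summable (\<lambda>i. (cmod (v i))\<^sup>2)" "(\<Sum>i. (cmod (v i))\<^sup>2) < 1"
    and sw: "summable (\<lambda>i. (cmod (w i))\<^sup>2)" "(\<Sum>i. (cmod (w i))\<^sup>2) < 1"
    using assms by (auto simp: unit_ball_def)
  let ?b = "\<lambda>i. ((cmod (v i))\<^sup>2 + (cmod (w i))\<^sup>2) / 2"
  have le: "cmod (v i * cnj (w i)) \<le> ?b i" for i
    using sum_squares_bound[of "cmod (v i)" "cmod (w i)"] by (simp add: norm_mult)
  have b: "summable ?b"
    by (intro summable_divide summable_add sv sw)
  show "summable (\<lambda>i. v i * cnj (w i))"
    by (rule summable_comparison_test'[OF b, of 0]) (use le in auto)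
  have sn: "summable (\<lambda>i. cmod (v i * cnj (w i)))"
    by (rule summable_comparison_test'[OF b, of 0]) (use le in auto)
  have "cmod (\<Sum>i. v i * cnj (w i)) \<le> (\<Sum>i. cmod (v i * cnj (w i)))"
    by (rule summable_norm[OF sn])
  also have "\<dots> \<le> (\<Sum>i. ?b i)"
    by (rule suminf_le[OF le sn b])
  also have "\<dots> = ((\<Sum>i. (cmod (v i))\<^sup>2) + (\<Sum>i. (cmod (w i))\<^sup>2)) / 2"
    using sv sw by (simp add: suminf_divide summable_add flip: suminf_add)
  also have "\<dots> < 1" using sv sw by simp
  finally show "cmod (\<Sum>i. v i * cnj (w i)) < 1" .
qed

lemma zero_mem_unit_ball: "(\<lambda>_. 0) \<in> unit_ball d"
  by (simp add: unit_ball_def)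

lemma scale_mem_unit_ball:
  assumes "w \<in> unit_ball d" "cmod s \<le> 1"
  shows "(\<lambda>i. s * w i) \<in> unit_ball d"
proof -
  have w: "summable (\<lambda>i. (cmod (w i))\<^sup>2)" "(\<Sum>i. (cmod (w i))\<^sup>2) < 1"
    using assms by (auto simp: unit_ball_def)
  have "(\<Sum>i. (cmod s)\<^sup>2 * (cmod (w i))\<^sup>2) = (cmod s)\<^sup>2 * (\<Sum>i. (cmod (w i))\<^sup>2)"
    by (rule suminf_mult[OF w(1)])
  also have "\<dots> \<le> 1 * (\<Sum>i. (cmod (w i))\<^sup>2)"
    using assms(2) w by (intro mult_right_mono suminf_nonneg) (auto simp: power_le_one)
  finally show ?thesis
    using assms w by (auto simp: unit_ball_def norm_mult power_mult_distrib intro: summable_mult)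
qed

definition two_point :: "complex \<Rightarrow> complex \<Rightarrow> nat \<Rightarrow> complex" where
  "two_point \<alpha> \<beta> = (\<lambda>i. if i = 0 then \<alpha> else if i = 1 then \<beta> else 0)"

lemma sums_two_point:
  fixes F :: "nat \<Rightarrow> 'a::real_normed_vector"
  assumes "\<And>i. i \<ge> 2 \<Longrightarrow> F i = 0"
  shows "F sums (F 0 + F 1)"
  using sums_finite[of "{0, 1}" F] assms by (auto simp: numeral_2_eq_2 not_le less_Suc_eq)

lemma two_point_mem_unit_ball:
  assumes "2 \<le> d" "(cmod \<alpha>)\<^sup>2 + (cmod \<beta>)\<^sup>2 < 1"
  shows "two_point \<alpha> \<beta> \<in> unit_ball d"
proof -
  have "(\<lambda>i. (cmod (two_point \<alpha> \<beta> i))\<^sup>2) sums ((cmod \<alpha>)\<^sup>2 + (cmod \<beta>)\<^sup>2)"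
    using sums_two_point[of "\<lambda>i. (cmod (two_point \<alpha> \<beta> i))\<^sup>2"] by (simp add: two_point_def)
  moreover have "two_point \<alpha> \<beta> i = 0" if "d \<le> enat i" for i
  proof -
    have "enat 2 \<le> enat i" using assms(1) that by (metis numeral_eq_enat order_trans)
    then show ?thesis by (simp add: two_point_def)
  qed
  ultimately show ?thesis
    using assms(2) by (auto simp: unit_ball_def sums_iff)
qed

locale drury_arveson =
  fixes d :: enat and H :: "(nat \<Rightarrow> complex) fspace"
  assumes d: "2 \<le> d" and space: "drury_arveson_space d H"
begin

sublocale reproducing_kernel_space "unit_ball d" drury_arveson_kernel H
  using space by unfold_locales (simp add: drury_arveson_space_def)

text \<open>Multiplying the kernel by the inner product removes exactly the constant kernel 1, which
  is positive; this is the source of the row contraction.\<close>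

lemma kernel_identity:
  assumes "v \<in> unit_ball d" "w \<in> unit_ball d"
  shows "drury_arveson_kernel v w * (\<Sum>i. v i * cnj (w i)) = drury_arveson_kernel v w - 1"
proof -
  have "(\<Sum>i. v i * cnj (w i)) \<noteq> 1"
    using unit_ball_inner_less_1[OF assms] by auto
  then show ?thesis
    by (simp add: drury_arveson_kernel_def divide_simps)
qed

text \<open>By \<open>kernel_identity\<close> the sum over all coordinates equals the squared norm
  of the combination minus \<open>|\<Sum> a w|^2\<close>. Since \<open>d\<close> may be infinite
  this is a limit of partial sums; these increase, so each one stays below it.\<close>

lemma coordinates_row_contraction:
  assumes S: "finite S" "S \<subseteq> unit_ball d"
  shows "(\<Sum>i<n. (hnorm H (kernel_comb S (\<lambda>w. a w * cnj (w i))))\<^sup>2) \<le> (hnorm H (kernel_comb S a))\<^sup>2"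
proof -
  let ?k = "drury_arveson_kernel"
  define U where "U N = (\<Sum>i<N. (hnorm H (kernel_comb S (\<lambda>w. a w * cnj (w i))))\<^sup>2)" for N
  have U: "U N = Re (\<Sum>w\<in>S. \<Sum>v\<in>S. a w * cnj (a v) * cnj (?k w v) * cnj (\<Sum>i<N. w i * cnj (v i)))" for N
  proof -
    have "U N = (\<Sum>i<N. Re (\<Sum>w\<in>S. \<Sum>v\<in>S. a w * cnj (a v) * cnj (?k w v) * cnj (w i * cnj (v i))))"
      unfolding U_def by (intro sum.cong refl) (simp add: hnorm_kernel_comb S mult_ac)
    also have "\<dots> = Re (\<Sum>i<N. \<Sum>w\<in>S. \<Sum>v\<in>S. a w * cnj (a v) * cnj (?k w v) * cnj (w i * cnj (v i)))"
      by simp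
    also have "(\<Sum>i<N. \<Sum>w\<in>S. \<Sum>v\<in>S. a w * cnj (a v) * cnj (?k w v) * cnj (w i * cnj (v i)))
        = (\<Sum>w\<in>S. \<Sum>v\<in>S. \<Sum>i<N. a w * cnj (a v) * cnj (?k w v) * cnj (w i * cnj (v i)))"
      by (subst sum.swap, intro sum.cong refl, rule sum.swap)
    finally show ?thesis
      by (simp add: sum_distrib_left)
  qed
  have "(\<lambda>N. Re (\<Sum>w\<in>S. \<Sum>v\<in>S. a w * cnj (a v) * cnj (?k w v) * cnj (\<Sum>i<N. w i * cnj (v i))))
      \<longlonglongrightarrow> Re (\<Sum>w\<in>S. \<Sum>v\<in>S. a w * cnj (a v) * cnj (?k w v) * cnj (\<Sum>i. w i * cnj (v i)))"
    using S by (intro tendsto_intros summable_LIMSEQ summable_unit_ball_inner) auto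
  also have "Re (\<Sum>w\<in>S. \<Sum>v\<in>S. a w * cnj (a v) * cnj (?k w v) * cnj (\<Sum>i. w i * cnj (v i)))
      = (hnorm H (kernel_comb S a))\<^sup>2 - (cmod (\<Sum>w\<in>S. a w))\<^sup>2"
  proof -
    have "(\<Sum>w\<in>S. \<Sum>v\<in>S. a w * cnj (a v) * cnj (?k w v) * cnj (\<Sum>i. w i * cnj (v i)))
        = (\<Sum>w\<in>S. \<Sum>v\<in>S. a w * cnj (a v) * cnj (?k w v) - a w * cnj (a v))"
    proof (intro sum.cong refl)
      fix w v assume "w \<in> S" "v \<in> S"
      then have "cnj (?k w v) * cnj (\<Sum>i. w i * cnj (v i)) = cnj (?k w v) - 1"
        using kernel_identity[of w v] S by (metis complex_cnj_diff complex_cnj_mult complex_cnj_one subsetD)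
      then show "a w * cnj (a v) * cnj (?k w v) * cnj (\<Sum>i. w i * cnj (v i))
          = a w * cnj (a v) * cnj (?k w v) - a w * cnj (a v)"
        by (simp add: mult.assoc right_diff_distrib)
    qed
    also have "\<dots> = (\<Sum>w\<in>S. \<Sum>v\<in>S. a w * cnj (a v) * cnj (?k w v))
        - complex_of_real ((cmod (\<Sum>w\<in>S. a w))\<^sup>2)"
      unfolding complex_norm_square by (simp add: sum_subtractf sum_product)
    finally show ?thesis
      by (simp only: hnorm_kernel_comb[OF S(2)] minus_complex.sel Re_complex_of_real)
  qed
  finally have lim: "U \<longlonglongrightarrow> (hnorm H (kernel_comb S a))\<^sup>2 - (cmod (\<Sum>w\<in>S. a w))\<^sup>2"
    unfolding U[symmetric] .
  have "incseq U"
    by (rule incseq_SucI) (simp add: U_def)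
  then have "U n \<le> (hnorm H (kernel_comb S a))\<^sup>2 - (cmod (\<Sum>w\<in>S. a w))\<^sup>2"
    using lim by (rule incseq_le)
  then show ?thesis
    using zero_le_power2[of "cmod (\<Sum>w\<in>S. a w)"] unfolding U_def by linarith
qed

lemma coordinate_row:
  assumes "f \<in> carr H" "g \<in> carr H"
  shows "(\<lambda>x. x 0 * f x + x 1 * g x) \<in> carr H"
    and "(hnorm H (\<lambda>x. x 0 * f x + x 1 * g x))\<^sup>2 \<le> (hnorm H f)\<^sup>2 + (hnorm H g)\<^sup>2"
  using row_mult_mem[where n = 2 and \<phi> = "\<lambda>i x. x i" and g = "\<lambda>i. if i = 0 then f else g", OF coordinates_row_contraction] assms
  by (simp_all add: numeral_2_eq_2)

lemma coordinate_mem: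
  assumes "f \<in> carr H"
  shows "(\<lambda>x. x 0 * f x) \<in> carr H" "(\<lambda>x. x 1 * f x) \<in> carr H"
  using coordinate_row(1)[OF assms zero_mem] coordinate_row(1)[OF zero_mem assms] by simp_all

lemma monomial_mem:
  assumes "f \<in> carr H"
  shows "(\<lambda>x. x 0 * x 1 ^ j * f x) \<in> carr H"
proof -
  have "(\<lambda>x. x 1 ^ j * f x) \<in> carr H"
    by (induction j) (use assms coordinate_mem(2) in \<open>force simp: mult.assoc\<close>)+
  then show ?thesis
    using coordinate_mem(1) by (fastforce simp: mult.assoc)
qed

text \<open>Horner scheme: the row is \<open>x 0 * g 0 + x 1 * h\<close>, with \<open>h\<close> a
  shorter row of the same kind, and the pair of coordinates is a row contraction.\<close>

lemma monomial_row:
  assumes "\<And>j. j < n \<Longrightarrow> g j \<in> carr H"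
  shows "(hnorm H (\<lambda>x. \<Sum>j<n. x 0 * x 1 ^ j * g j x))\<^sup>2 \<le> (\<Sum>j<n. (hnorm H (g j))\<^sup>2)"
  using assms
proof (induction n arbitrary: g)
  case 0
  then show ?case by (simp add: hnorm_zero)
next
  case (Suc n)
  let ?h = "\<lambda>x. \<Sum>j<n. x 0 * x 1 ^ j * g (Suc j) x"
  have h: "?h \<in> carr H"
    by (intro sum_mem monomial_mem) (use Suc.prems in auto)
  have "(\<lambda>x. \<Sum>j<Suc n. x 0 * x 1 ^ j * g j x) = (\<lambda>x. x 0 * g 0 x + x 1 * ?h x)"
    by (simp add: sum.lessThan_Suc_shift sum_distrib_left mult_ac del: sum.lessThan_Suc)
  then have "(hnorm H (\<lambda>x. \<Sum>j<Suc n. x 0 * x 1 ^ j * g j x))\<^sup>2 \<le> (hnorm H (g 0))\<^sup>2 + (hnorm H ?h)\<^sup>2"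
    using coordinate_row(2)[OF Suc.prems[of 0] h] by simp
  also have "(hnorm H ?h)\<^sup>2 \<le> (\<Sum>j<n. (hnorm H (g (Suc j)))\<^sup>2)"
    by (rule Suc.IH) (use Suc.prems in auto)
  finally show ?case
    by (simp add: sum.lessThan_Suc_shift del: sum.lessThan_Suc)
qed

definition one :: "(nat \<Rightarrow> complex) \<Rightarrow> complex" where
  "one x = (if x \<in> unit_ball d then 1 else 0)"

text \<open>The kernel at the origin is constant, so its squared norm is its value there.\<close>

lemma one_mem: "one \<in> carr H" and hnorm_one: "hnorm H one = 1"
proof -
  have eq: "one = kernel_fun (\<lambda>_. 0)"
    by (auto simp: one_def kernel_fun_def drury_arveson_kernel_def)
  show mem: "one \<in> carr H"
    unfolding eq by (rule kernel_fun_mem[OF zero_mem_unit_ball])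
  have "ip H one one = 1"
    using reproducing[OF mem zero_mem_unit_ball] zero_mem_unit_ball by (simp add: one_def flip: eq)
  then show "hnorm H one = 1" by (simp add: hnorm_def)
qed

text \<open>The coordinate row applied to \<open>cnj \<alpha> * g\<close> and
  \<open>cnj \<beta> * g\<close>.\<close>

lemma linear_mult:
  assumes g: "g \<in> carr H"
  shows "(\<lambda>x. (x 0 * cnj \<alpha> + x 1 * cnj \<beta>) * g x) \<in> carr H"
    and "hnorm H (\<lambda>x. (x 0 * cnj \<alpha> + x 1 * cnj \<beta>) * g x)
           \<le> sqrt ((cmod \<alpha>)\<^sup>2 + (cmod \<beta>)\<^sup>2) * hnorm H g"
proof -
  have eq: "(\<lambda>x. x 0 * (cnj \<alpha> * g x) + x 1 * (cnj \<beta> * g x))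
      = (\<lambda>x. (x 0 * cnj \<alpha> + x 1 * cnj \<beta>) * g x)"
    by (simp add: algebra_simps)
  note row = coordinate_row[OF scale_mem[OF g] scale_mem[OF g], of "cnj \<alpha>" "cnj \<beta>", unfolded eq]
  then show "(\<lambda>x. (x 0 * cnj \<alpha> + x 1 * cnj \<beta>) * g x) \<in> carr H" by simp
  note row(2)
  also have "(hnorm H (\<lambda>x. cnj \<alpha> * g x))\<^sup>2 + (hnorm H (\<lambda>x. cnj \<beta> * g x))\<^sup>2
      = (sqrt ((cmod \<alpha>)\<^sup>2 + (cmod \<beta>)\<^sup>2) * hnorm H g)\<^sup>2"
    using g by (simp add: hnorm_scale power_mult_distrib distrib_right)
  finally show "hnorm H (\<lambda>x. (x 0 * cnj \<alpha> + x 1 * cnj \<beta>) * g x)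
      \<le> sqrt ((cmod \<alpha>)\<^sup>2 + (cmod \<beta>)\<^sup>2) * hnorm H g"
    by (rule power2_le_imp_le) (simp add: hnorm_nonneg g)
qed

lemma linear_power_mult:
  assumes f: "f \<in> carr H"
  shows "(\<lambda>x. (x 0 * cnj \<alpha> + x 1 * cnj \<beta>) ^ m * f x) \<in> carr H \<and>
    hnorm H (\<lambda>x. (x 0 * cnj \<alpha> + x 1 * cnj \<beta>) ^ m * f x)
      \<le> sqrt ((cmod \<alpha>)\<^sup>2 + (cmod \<beta>)\<^sup>2) ^ m * hnorm H f"
proof (induction m)
  case (Suc m)
  let ?l = "\<lambda>x :: nat \<Rightarrow> complex. x 0 * cnj \<alpha> + x 1 * cnj \<beta>" and ?\<rho> = "sqrt ((cmod \<alpha>)\<^sup>2 + (cmod \<beta>)\<^sup>2)"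
  have eq: "(\<lambda>x. ?l x ^ Suc m * f x) = (\<lambda>x. ?l x * (?l x ^ m * f x))"
    by (simp add: mult.assoc)
  have mem: "(\<lambda>x. ?l x ^ m * f x) \<in> carr H"
    and le: "hnorm H (\<lambda>x. ?l x ^ m * f x) \<le> ?\<rho> ^ m * hnorm H f"
    using Suc by auto
  have "hnorm H (\<lambda>x. ?l x ^ Suc m * f x) \<le> ?\<rho> * hnorm H (\<lambda>x. ?l x ^ m * f x)"
    unfolding eq by (rule linear_mult(2)[OF mem])
  also have "\<dots> \<le> ?\<rho> * (?\<rho> ^ m * hnorm H f)"
    by (intro mult_left_mono le) simp
  finally show ?case
    unfolding eq using linear_mult(1)[OF mem] by (simp add: mult.assoc)
qed (use f in simp)

text \<open>The homogeneous part of degree \<open>j + 1\<close> of the kernel at \<open>w = (\<alpha>, \<beta>, 0, \<dots>)\<close> is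
  \<open>\<langle>x, w\<rangle> ^ (j + 1)\<close>; testing a monomial against it bounds its norm from below.\<close>

lemma monomial_evaluation_le:
  assumes \<rho>: "(cmod \<alpha>)\<^sup>2 + (cmod \<beta>)\<^sup>2 < 1"
  shows "cmod (\<alpha> * \<beta> ^ j)
    \<le> hnorm H (\<lambda>x. x 0 * x 1 ^ j * one x) * sqrt ((cmod \<alpha>)\<^sup>2 + (cmod \<beta>)\<^sup>2) ^ Suc j"
proof -
  define w where "w = two_point \<alpha> \<beta>"
  define l where "l x = x 0 * cnj \<alpha> + x 1 * cnj \<beta>" for x :: "nat \<Rightarrow> complex"
  define r where "r = sqrt ((cmod \<alpha>)\<^sup>2 + (cmod \<beta>)\<^sup>2)"
  define f where "f = (\<lambda>x. x 0 * x 1 ^ j * one x)"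
  define G where "G m = (\<lambda>x. l x ^ m * one x)" for m
  have r: "0 \<le> r" "r < 1" using \<rho> by (auto simp: r_def)
  have w: "w \<in> unit_ball d" unfolding w_def by (rule two_point_mem_unit_ball[OF d \<rho>])
  have f: "f \<in> carr H" unfolding f_def by (rule monomial_mem[OF one_mem])
  have G: "G m \<in> carr H" "hnorm H (G m) \<le> r ^ m" for m
    using linear_power_mult[OF one_mem, of \<alpha> \<beta> m] by (simp_all add: G_def l_def r_def hnorm_one)
  \<comment> \<open>On the complex line through \<open>w\<close>, reproducing at \<open>s w\<close>
    and expanding the kernel geometrically makes the inner products with \<open>G m\<close> the
    Taylor coefficients in \<open>s\<close>.\<close>
  have "(\<lambda>m. ip H f (G m) * s ^ m) sums f (\<lambda>i. s * w i)" if s: "cmod s < 1" for s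
  proof -
    let ?u = "\<lambda>i. s * w i"
    have u: "?u \<in> unit_ball d"
      using scale_mem_unit_ball[OF w] s by simp
    \<comment> \<open>Remainder of the finite geometric series for \<open>1 / (1 - q)\<close>; its
      norm decays like \<open>r ^ M\<close>, and \<open>r < 1\<close>.\<close>
    define R where "R M = (\<lambda>x. cnj s ^ M * (l x ^ M * kernel_fun ?u x))" for M
    have lR: "(\<lambda>x. l x ^ M * kernel_fun ?u x) \<in> carr H"
      "hnorm H (\<lambda>x. l x ^ M * kernel_fun ?u x) \<le> r ^ M * hnorm H (kernel_fun ?u)" for M
      using linear_power_mult[OF kernel_fun_mem[OF u], of \<alpha> \<beta> M] by (simp_all add: l_def r_def)
    have R: "R M \<in> carr H" for M
      unfolding R_def by (rule scale_mem[OF lR(1)])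
    have R_le: "hnorm H (R M) \<le> r ^ M * hnorm H (kernel_fun ?u)" for M
    proof -
      have "hnorm H (R M) \<le> 1 * hnorm H (\<lambda>x. l x ^ M * kernel_fun ?u x)"
        unfolding R_def using lR s
        by (simp add: hnorm_scale norm_power mult_left_le_one_le hnorm_nonneg power_le_one)
      then show ?thesis using lR(2)[of M] by simp
    qed
    have split: "kernel_fun ?u = (\<lambda>x. (\<Sum>m<M. cnj s ^ m * G m x) + R M x)" for M
    proof
      fix x
      show "kernel_fun ?u x = (\<Sum>m<M. cnj s ^ m * G m x) + R M x"
      proof (cases "x \<in> unit_ball d")
        case True
        define q where "q = cnj s * l x"
        have "(\<lambda>i. x i * cnj (s * w i)) sums (x 0 * cnj (s * w 0) + x 1 * cnj (s * w 1))"
          by (rule sums_two_point) (simp add: w_def two_point_def)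
        then have inner: "(\<Sum>i. x i * cnj (s * w i)) = q"
          by (simp add: sums_iff q_def l_def w_def two_point_def algebra_simps)
        have "q \<noteq> 1"
          using unit_ball_inner_less_1[OF True u] unfolding inner by auto
        then have "1 / (1 - q) = (\<Sum>m<M. q ^ m) + q ^ M * (1 / (1 - q))"
          by (simp add: sum_gp_strict divide_simps)
        moreover have k: "kernel_fun ?u x = 1 / (1 - q)"
          using True inner by (simp add: kernel_fun_def drury_arveson_kernel_def)
        moreover have "R M x = q ^ M * (1 / (1 - q))"
          unfolding R_def k by (simp add: q_def power_mult_distrib)
        moreover have "(\<Sum>m<M. cnj s ^ m * G m x) = (\<Sum>m<M. q ^ m)"
          using True by (simp add: G_def one_def q_def power_mult_distrib)
        ultimately show ?thesis
          by metis
      qed (simp add: G_def R_def one_def kernel_fun_def)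
    qed
    have expand: "f ?u = (\<Sum>m<M. ip H f (G m) * s ^ m) + ip H f (R M)" for M
    proof -
      have "f ?u = ip H f (kernel_fun ?u)" by (rule reproducing[OF f u, symmetric])
      also have "\<dots> = ip H f (\<lambda>x. \<Sum>m<M. cnj s ^ m * G m x) + ip H f (R M)"
        by (subst split[of M], rule ip_add_right) (auto intro!: sum_mem scale_mem G R f)
      also have "ip H f (\<lambda>x. \<Sum>m<M. cnj s ^ m * G m x) = (\<Sum>m<M. ip H f (\<lambda>x. cnj s ^ m * G m x))"
        by (rule ip_sum_right) (auto intro!: scale_mem G f)
      also have "\<dots> = (\<Sum>m<M. ip H f (G m) * s ^ m)"
        by (intro sum.cong refl, subst ip_scale_right) (simp_all add: G(1) f mult.commute)
      finally show ?thesis .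
    qed
    have "(\<lambda>M. hnorm H f * (r ^ M * hnorm H (kernel_fun ?u))) \<longlonglongrightarrow> hnorm H f * (0 * hnorm H (kernel_fun ?u))"
      using r by (intro tendsto_intros LIMSEQ_realpow_zero)
    moreover have "cmod (ip H f (R M)) \<le> hnorm H f * (r ^ M * hnorm H (kernel_fun ?u))" for M
      using Cauchy_Schwarz[OF f R, of M] R_le[of M] hnorm_nonneg[OF f]
      by (meson mult_left_mono order_trans)
    ultimately have "(\<lambda>M. ip H f (R M)) \<longlonglongrightarrow> 0"
      using Lim_null_comparison[of "\<lambda>M. ip H f (R M)"
          "\<lambda>M. hnorm H f * (r ^ M * hnorm H (kernel_fun ?u))" sequentially]
      by simp
    then have "(\<lambda>M. f ?u - ip H f (R M)) \<longlonglongrightarrow> f ?u - 0"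
      by (intro tendsto_intros)
    moreover have "f ?u - ip H f (R M) = (\<Sum>m<M. ip H f (G m) * s ^ m)" for M
      using expand[of M] by simp
    ultimately show ?thesis by (simp add: sums_def)
  qed
  then have "taylor_coeff (\<lambda>s. f (\<lambda>i. s * w i)) (Suc j) = ip H f (G (Suc j))"
    using taylor_coeff_unique[of 1 "\<lambda>m. ip H f (G m)" "\<lambda>s. f (\<lambda>i. s * w i)" "Suc j"] by simp
  \<comment> \<open>Evaluated directly, \<open>f\<close> on this line is one monomial in
    \<open>s\<close>; comparing coefficients of degree \<open>j + 1\<close> isolates the desired
    inner product.\<close>
  moreover have "(\<lambda>m. (if m = Suc j then \<alpha> * \<beta> ^ j else 0) * s ^ m) sums f (\<lambda>i. s * w i)"
    if s: "cmod s < 1" for s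
  proof -
    have "(\<lambda>m. if m = Suc j then \<alpha> * \<beta> ^ j * s ^ m else 0) sums (\<alpha> * \<beta> ^ j * s ^ Suc j)"
      by (rule sums_single)
    moreover have "f (\<lambda>i. s * w i) = \<alpha> * \<beta> ^ j * s ^ Suc j"
      using scale_mem_unit_ball[OF w, of s] s
      by (simp add: f_def one_def w_def two_point_def power_mult_distrib)
    ultimately show ?thesis by (simp add: if_distrib[of "\<lambda>z. z * _"] cong: if_cong)
  qed
  then have "taylor_coeff (\<lambda>s. f (\<lambda>i. s * w i)) (Suc j) = \<alpha> * \<beta> ^ j"
    using taylor_coeff_unique[of 1 "\<lambda>m. if m = Suc j then \<alpha> * \<beta> ^ j else 0"
        "\<lambda>s. f (\<lambda>i. s * w i)" "Suc j"] by simp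
  ultimately have "\<alpha> * \<beta> ^ j = ip H f (G (Suc j))" by simp
  then show ?thesis
    using Cauchy_Schwarz[OF f G(1), of "Suc j"] G(2)[of "Suc j"] hnorm_nonneg[OF f]
    unfolding f_def[symmetric] r_def[symmetric] by (metis mult_left_mono order_trans)
qed

text \<open>The true value is \<open>1 / (j + 1)\<close>. Point evaluation gives
  \<open>j^j / (j+1)^(j+1)\<close>, smaller by the factor \<open>(1 + 1/j)^j\<close>, at most
  \<open>e\<close> and so at most 3.\<close>

lemma hnorm_monomial_ge: "1 / (3 * (real j + 1)) \<le> (hnorm H (\<lambda>x. x 0 * x 1 ^ j * one x))\<^sup>2"
proof -
  define h where "h = hnorm H (\<lambda>x. x 0 * x 1 ^ j * one x)"
  \<comment> \<open>The ratio \<open>|\<beta>|^2 = j * |\<alpha>|^2\<close> maximises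
    \<open>|\<alpha> \<beta>^j|\<close> at fixed radius. The scale \<open>t\<close> merely puts the
    point inside the ball and cancels later.\<close>
  define t where "t = 1 / (real j + 2)"
  have t: "t > 0" by (simp add: t_def)
  have sq: "(cmod (of_real t))\<^sup>2 + (cmod (of_real (t * sqrt (real j))))\<^sup>2 = t\<^sup>2 * (real j + 1)"
    by (simp add: norm_mult power_mult_distrib distrib_left)
  have "(real j + 2)\<^sup>2 = real j * real j + 4 * real j + 4"
    by (simp add: power2_eq_square algebra_simps)
  then have "real j + 1 < (real j + 2)\<^sup>2"
    using mult_nonneg_nonneg[of "real j" "real j"] by linarith
  then have "t\<^sup>2 * (real j + 1) < 1"
    by (simp add: t_def power_divide)
  then have "cmod (of_real t * of_real (t * sqrt (real j)) ^ j) \<le> h * sqrt (t\<^sup>2 * (real j + 1)) ^ Suc j"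
    using monomial_evaluation_le[of "of_real t" "of_real (t * sqrt (real j))" j]
    unfolding sq h_def by simp
  also have "sqrt (t\<^sup>2 * (real j + 1)) = t * sqrt (real j + 1)"
    using t by (simp add: real_sqrt_mult)
  also have "cmod (of_real t * of_real (t * sqrt (real j)) ^ j) = t ^ Suc j * sqrt (real j) ^ j"
    using t by (simp add: norm_mult norm_power power_mult_distrib)
  finally have "t ^ Suc j * sqrt (real j) ^ j \<le> t ^ Suc j * (h * sqrt (real j + 1) ^ Suc j)"
    by (simp add: power_mult_distrib mult_ac)
  then have "sqrt (real j) ^ j \<le> h * sqrt (real j + 1) ^ Suc j"
    using t by (simp add: mult_le_cancel_left_pos del: power_Suc)
  then have "(sqrt (real j) ^ j)\<^sup>2 \<le> (h * sqrt (real j + 1) ^ Suc j)\<^sup>2"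
    by (intro power_mono) auto
  also have "(sqrt (real j) ^ j)\<^sup>2 = real j ^ j"
    by (simp flip: real_sqrt_power)
  also have "(h * sqrt (real j + 1) ^ Suc j)\<^sup>2 = h\<^sup>2 * (real j + 1) ^ Suc j"
    by (simp add: power_mult_distrib del: power_Suc flip: real_sqrt_power)
  finally have main: "real j ^ j \<le> h\<^sup>2 * (real j + 1) ^ Suc j" .
  have "(real j + 1) ^ j \<le> 3 * real j ^ j"
  proof (cases "j = 0")
    case False
    then have "(real j + 1) ^ j = (1 + 1 / real j) ^ j * real j ^ j"
      by (simp add: field_simps flip: power_mult_distrib)
    also have "\<dots> \<le> 3 * real j ^ j"
      using exp_ge_one_plus_x_over_n_power_n[of j 1] exp_le False by (intro mult_right_mono) auto
    finally show ?thesis .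
  qed simp
  then have "(real j + 1) ^ j \<le> 3 * (h\<^sup>2 * (real j + 1) ^ Suc j)"
    using main by linarith
  then have "(real j + 1) ^ j * 1 \<le> (real j + 1) ^ j * (3 * h\<^sup>2 * (real j + 1))"
    by (simp add: mult_ac)
  then have "1 \<le> 3 * h\<^sup>2 * (real j + 1)"
    by (subst (asm) mult_le_cancel_left_pos) auto
  then have "1 \<le> h\<^sup>2 * (3 * (real j + 1))"
    by (simp only: mult_ac)
  then show ?thesis
    unfolding h_def[symmetric] by (subst pos_divide_le_eq) auto
qed

lemma no_cb_inverse: "\<not> has_cb_inverse (mult_os H) (mult_weak_product_os H) mult_inclusion"
proof
  assume "has_cb_inverse (mult_os H) (mult_weak_product_os H) mult_inclusion"
  then obtain C where C: "\<And>k \<phi> f. row_contraction H k \<phi> \<Longrightarrow> f \<in> carr H \<Longrightarrow> hnorm H f \<le> 1 \<Longrightarrow>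
       (\<Sum>i<k. (hnorm H (\<lambda>x. \<phi> i x * f x))\<^sup>2) \<le> C"
    using cb_inverse_bounds_columns by blast
  \<comment> \<open>Multipliers must vanish off the ball, so the polynomial is cut off; products
    with elements of \<open>carr H\<close> do not change.\<close>
  define \<phi> where "\<phi> j = (\<lambda>x. if x \<in> unit_ball d then x 0 * x 1 ^ j else 0)" for j
  have \<phi>: "(\<lambda>x. \<phi> j x * f x) = (\<lambda>x. x 0 * x 1 ^ j * f x)" if "f \<in> carr H" for f j
    using vanishes[OF that] by (auto simp: \<phi>_def)
  have row: "row_contraction H n \<phi>" for n
    unfolding row_contraction_def
  proof (intro conjI allI impI ballI)
    show "vanishes_off (pts H) (\<phi> i)" for i
      by (simp add: vanishes_off_def \<phi>_def pts_eq)
    show "(\<lambda>x. \<phi> i x * f x) \<in> carr H" if "f \<in> carr H" for i f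
      using monomial_mem[OF that] by (simp add: \<phi>[OF that])
    fix g :: "nat \<Rightarrow> (nat \<Rightarrow> complex) \<Rightarrow> complex" assume g: "\<forall>i<n. g i \<in> carr H"
    have "(\<Sum>i<n. \<phi> i x * g i x) = (\<Sum>i<n. x 0 * x 1 ^ i * g i x)" for x
      using g \<phi> by (intro sum.cong refl) (metis lessThan_iff)
    then show "(hnorm H (\<lambda>x. \<Sum>i<n. \<phi> i x * g i x))\<^sup>2 \<le> (\<Sum>i<n. (hnorm H (g i))\<^sup>2)"
      using monomial_row[of n g] g by simp
  qed
  have "harm n \<le> 3 * C" for n
  proof -
    have "harm n / 3 = (\<Sum>j<n. 1 / (3 * (real j + 1)))"
      by (simp add: harm_altdef sum_divide_distrib inverse_eq_divide add.commute mult.commute)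
    also have "\<dots> \<le> (\<Sum>j<n. (hnorm H (\<lambda>x. \<phi> j x * one x))\<^sup>2)"
      by (intro sum_mono) (simp only: \<phi>[OF one_mem] hnorm_monomial_ge)
    also have "\<dots> \<le> C"
      by (rule C[OF row one_mem]) (simp add: hnorm_one)
    finally show ?thesis by simp
  qed
  moreover obtain n where "harm n > 3 * C"
    using harm_at_top filterlim_at_top_dense[of harm sequentially] eventually_happens' sequentially_bot
    by (metis (mono_tags, lifting))
  ultimately show False
    using not_less by blast
qed

end

section \<open>The Dirichlet space\<close>

lemma carr_dirichlet:
  "f \<in> carr dirichlet_space \<longleftrightarrow> vanishes_off (ball 0 1) f \<and> f holomorphic_on ball 0 1 \<and>
     summable (\<lambda>n. (real n + 1) * (cmod (taylor_coeff f n))\<^sup>2)"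
  by (simp add: dirichlet_space_def)

lemma ip_dirichlet:
  "ip dirichlet_space f g = (\<Sum>n. (of_nat n + 1) * taylor_coeff f n * cnj (taylor_coeff g n))"
  by (simp add: dirichlet_space_def)

lemma taylor_coeff_sums:
  assumes "f \<in> carr dirichlet_space" "cmod z < 1"
  shows "(\<lambda>n. taylor_coeff f n * z ^ n) sums f z"
  using holomorphic_power_series[of f 0 1 z] assms by (simp add: carr_dirichlet taylor_coeff_def)

lemma taylor_coeff_add:
  assumes "f \<in> carr dirichlet_space" "g \<in> carr dirichlet_space"
  shows "taylor_coeff (\<lambda>z. f z + g z) n = taylor_coeff f n + taylor_coeff g n"
  using sums_add[OF taylor_coeff_sums[OF assms(1)] taylor_coeff_sums[OF assms(2)]]
  by (intro taylor_coeff_unique[of 1]) (simp_all add: distrib_right)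

lemma taylor_coeff_scale:
  assumes "f \<in> carr dirichlet_space"
  shows "taylor_coeff (\<lambda>z. c * f z) n = c * taylor_coeff f n"
  using sums_mult[OF taylor_coeff_sums[OF assms]]
  by (intro taylor_coeff_unique[of 1]) (simp_all add: mult.assoc)

lemma taylor_coeff_shift:
  assumes "f \<in> carr dirichlet_space"
  shows "taylor_coeff (\<lambda>z. z ^ i * f z) n = (if n < i then 0 else taylor_coeff f (n - i))"
proof (rule taylor_coeff_unique[of 1])
  fix z :: complex assume "cmod z < 1"
  then have "(\<lambda>n. z ^ i * (taylor_coeff f n * z ^ n)) sums (z ^ i * f z)"
    using assms by (intro sums_mult taylor_coeff_sums)
  then show "(\<lambda>n. (if n < i then 0 else taylor_coeff f (n - i)) * z ^ n) sums (z ^ i * f z)"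
    by (subst sums_zero_iff_shift[of i, symmetric]) (simp_all add: power_add mult_ac)
qed simp

lemma taylor_coeff_zero: "taylor_coeff (\<lambda>z. 0) n = 0"
  by (rule taylor_coeff_unique[of 1]) simp_all

lemma summable_dirichlet_ip:
  assumes "f \<in> carr dirichlet_space" "g \<in> carr dirichlet_space"
  shows "summable (\<lambda>n. (of_nat n + 1) * taylor_coeff f n * cnj (taylor_coeff g n))"
proof (rule summable_comparison_test')
  show "summable (\<lambda>n. ((real n + 1) * (cmod (taylor_coeff f n))\<^sup>2 + (real n + 1) * (cmod (taylor_coeff g n))\<^sup>2) / 2)"
    using assms by (intro summable_divide summable_add) (auto simp: carr_dirichlet)
  fix n
  have "cmod (of_nat n + 1 :: complex) = real n + 1"
    by (metis norm_of_nat of_nat_Suc add.commute)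
  then have "norm ((of_nat n + 1) * taylor_coeff f n * cnj (taylor_coeff g n)) =
      (real n + 1) * (2 * cmod (taylor_coeff f n) * cmod (taylor_coeff g n)) / 2"
    by (simp add: norm_mult)
  also have "\<dots> \<le> (real n + 1) * ((cmod (taylor_coeff f n))\<^sup>2 + (cmod (taylor_coeff g n))\<^sup>2) / 2"
    by (intro divide_right_mono mult_left_mono sum_squares_bound) simp_all
  finally show "norm ((of_nat n + 1) * taylor_coeff f n * cnj (taylor_coeff g n))
      \<le> ((real n + 1) * (cmod (taylor_coeff f n))\<^sup>2 + (real n + 1) * (cmod (taylor_coeff g n))\<^sup>2) / 2"
    by (simp add: distrib_left)
qed

lemma ip_dirichlet_self:
  assumes "f \<in> carr dirichlet_space"
  shows "ip dirichlet_space f f = complex_of_real (\<Sum>n. (real n + 1) * (cmod (taylor_coeff f n))\<^sup>2)"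
proof -
  have sums: "(\<lambda>n. complex_of_real ((real n + 1) * (cmod (taylor_coeff f n))\<^sup>2)) sums
      complex_of_real (\<Sum>n. (real n + 1) * (cmod (taylor_coeff f n))\<^sup>2)"
    using assms by (intro sums_of_real summable_sums) (simp add: carr_dirichlet)
  have "(of_nat n + 1) * taylor_coeff f n * cnj (taylor_coeff f n)
      = complex_of_real ((real n + 1) * (cmod (taylor_coeff f n))\<^sup>2)" for n
    unfolding of_real_mult complex_norm_square by simp
  then have "ip dirichlet_space f f = (\<Sum>n. complex_of_real ((real n + 1) * (cmod (taylor_coeff f n))\<^sup>2))"
    by (simp only: ip_dirichlet)
  also have "\<dots> = complex_of_real (\<Sum>n. (real n + 1) * (cmod (taylor_coeff f n))\<^sup>2)"
    by (rule sums_unique[OF sums, symmetric])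
  finally show ?thesis .
qed

section \<open>The coefficient form of the Dirichlet inner product\<close>

interpretation dirichlet: semi_inner_fspace dirichlet_space
proof
  let ?c = "carr dirichlet_space"
  show "fun_subspace ?c"
    unfolding fun_subspace_def
  proof (intro conjI ballI allI)
    show "(\<lambda>x. 0) \<in> ?c"
      by (simp add: carr_dirichlet vanishes_off_def taylor_coeff_zero)
    show "(\<lambda>x. c * f x) \<in> ?c" if "f \<in> ?c" for c f
      using that summable_mult[of "\<lambda>n. (real n + 1) * (cmod (taylor_coeff f n))\<^sup>2" "(cmod c)\<^sup>2"]
      by (auto simp: carr_dirichlet vanishes_off_def taylor_coeff_scale[OF that] norm_mult
          power_mult_distrib mult_ac intro!: holomorphic_intros)
    show "(\<lambda>x. f x + g x) \<in> ?c" if fg: "f \<in> ?c" "g \<in> ?c" for f g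
    proof -
      have "summable (\<lambda>n. (real n + 1) * (cmod (taylor_coeff (\<lambda>x. f x + g x) n))\<^sup>2)"
      proof (rule summable_comparison_test')
        show "summable (\<lambda>n. 2 * ((real n + 1) * (cmod (taylor_coeff f n))\<^sup>2 + (real n + 1) * (cmod (taylor_coeff g n))\<^sup>2))"
          using fg by (intro summable_mult summable_add) (auto simp: carr_dirichlet)
        fix n
        let ?a = "taylor_coeff f n" and ?b = "taylor_coeff g n"
        have "(cmod (?a + ?b))\<^sup>2 \<le> (cmod ?a + cmod ?b)\<^sup>2"
          by (intro power_mono norm_triangle_ineq) simp
        also have "\<dots> \<le> 2 * ((cmod ?a)\<^sup>2 + (cmod ?b)\<^sup>2)"
          using sum_squares_bound[of "cmod ?a" "cmod ?b"] by (simp add: power2_sum)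
        finally have "(real n + 1) * (cmod (?a + ?b))\<^sup>2 \<le> (real n + 1) * (2 * ((cmod ?a)\<^sup>2 + (cmod ?b)\<^sup>2))"
          by (intro mult_left_mono) simp_all
        then show "norm ((real n + 1) * (cmod (taylor_coeff (\<lambda>x. f x + g x) n))\<^sup>2)
            \<le> 2 * ((real n + 1) * (cmod ?a)\<^sup>2 + (real n + 1) * (cmod ?b)\<^sup>2)"
          by (simp add: taylor_coeff_add[OF fg] algebra_simps)
      qed
      then show ?thesis
        using fg by (auto simp: carr_dirichlet vanishes_off_def intro!: holomorphic_intros)
    qed
  qed
  show "linear_functional_on ?c (\<lambda>f. ip dirichlet_space f g)" if g: "g \<in> ?c" for g
    unfolding linear_functional_on_def ip_dirichlet
  proof (intro conjI ballI allI)
    fix f h assume f: "f \<in> ?c" and h: "h \<in> ?c"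
    show "(\<Sum>n. (of_nat n + 1) * taylor_coeff (\<lambda>x. f x + h x) n * cnj (taylor_coeff g n))
        = (\<Sum>n. (of_nat n + 1) * taylor_coeff f n * cnj (taylor_coeff g n))
        + (\<Sum>n. (of_nat n + 1) * taylor_coeff h n * cnj (taylor_coeff g n))"
      unfolding suminf_add[OF summable_dirichlet_ip[OF f g] summable_dirichlet_ip[OF h g]]
      by (simp add: taylor_coeff_add f h algebra_simps)
  next
    fix c f assume f: "f \<in> ?c"
    show "(\<Sum>n. (of_nat n + 1) * taylor_coeff (\<lambda>x. c * f x) n * cnj (taylor_coeff g n))
        = c * (\<Sum>n. (of_nat n + 1) * taylor_coeff f n * cnj (taylor_coeff g n))"
      unfolding suminf_mult[OF summable_dirichlet_ip[OF f g], symmetric]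
      by (simp add: taylor_coeff_scale f mult_ac)
  qed
  show "ip dirichlet_space g f = cnj (ip dirichlet_space f g)" if f: "f \<in> ?c" and g: "g \<in> ?c" for f g
  proof -
    have "(\<lambda>n. cnj ((of_nat n + 1) * taylor_coeff f n * cnj (taylor_coeff g n))) sums
        cnj (ip dirichlet_space f g)"
      unfolding sums_cnj ip_dirichlet by (intro summable_sums summable_dirichlet_ip f g)
    then show ?thesis
      by (simp add: ip_dirichlet[of g f] sums_iff mult_ac)
  qed
  show "0 \<le> Re (ip dirichlet_space f f)" if "f \<in> ?c" for f
    using that by (simp add: ip_dirichlet_self) (auto simp: carr_dirichlet intro!: suminf_nonneg)
qed

lemma hnorm_dirichlet:
  assumes "f \<in> carr dirichlet_space"
  shows "(hnorm dirichlet_space f)\<^sup>2 = (\<Sum>n. (real n + 1) * (cmod (taylor_coeff f n))\<^sup>2)"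
  using dirichlet.hnorm_sq[OF assms] by (simp add: ip_dirichlet_self[OF assms])

lemma shift_mem_dirichlet:
  assumes f: "f \<in> carr dirichlet_space"
  shows "(\<lambda>z. z ^ i * f z) \<in> carr dirichlet_space"
proof -
  have "summable (\<lambda>n. (real (n + i) + 1) * (cmod (taylor_coeff f n))\<^sup>2)"
  proof (rule summable_comparison_test')
    \<comment> \<open>The weights compare by \<open>n + i + 1 <= (i + 1) * (n + 1)\<close>.\<close>
    show "summable (\<lambda>n. real (Suc i) * ((real n + 1) * (cmod (taylor_coeff f n))\<^sup>2))"
      using f by (intro summable_mult) (simp add: carr_dirichlet)
    show "norm ((real (n + i) + 1) * (cmod (taylor_coeff f n))\<^sup>2)
        \<le> real (Suc i) * ((real n + 1) * (cmod (taylor_coeff f n))\<^sup>2)" for n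
      by (simp add: mult.assoc[symmetric]) (intro mult_right_mono, auto simp: algebra_simps)
  qed
  then have "summable (\<lambda>n. (real n + 1) * (cmod (taylor_coeff (\<lambda>z. z ^ i * f z) n))\<^sup>2)"
    by (subst summable_iff_shift[of _ i, symmetric]) (simp add: taylor_coeff_shift[OF f])
  then show ?thesis
    using f by (auto simp: carr_dirichlet vanishes_off_def intro!: holomorphic_intros)
qed

section \<open>A row of small norm whose column is large\<close>

text \<open>With \<open>x = i + 1\<close> and \<open>y = m - i + 1\<close> one has
  \<open>m + 1 <= x + y\<close>, so each term is at most \<open>1/x + 1/y\<close>, and either family
  of reciprocals sums to at most \<open>harm n\<close>.\<close>

lemma harm_convolution_le:
  assumes "n \<le> k" "n \<le> Suc m"
  shows "(\<Sum>i<n. (real m + 1) / ((real i + 1) * (real (m - i) + 1))) \<le> 2 * harm k"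
proof -
  have "(\<Sum>i<n. (real m + 1) / ((real i + 1) * (real (m - i) + 1)))
      \<le> (\<Sum>i<n. inverse (real (Suc i)) + inverse (real (Suc (n - Suc i))))"
  proof (rule sum_mono)
    fix i assume i: "i \<in> {..<n}"
    define x y where "x = real i + 1" and "y = real (m - i) + 1"
    have xy: "x > 0" "y > 0" "real m + 1 \<le> x + y"
      using i assms by (auto simp: x_def y_def of_nat_diff)
    have "(real m + 1) / (x * y) \<le> (x + y) / (x * y)"
      using xy by (intro divide_right_mono) auto
    also have "\<dots> = inverse x + inverse y"
      using xy by (simp add: field_simps)
    also have "inverse y \<le> inverse (real (Suc (n - Suc i)))"
      using i assms by (intro le_imp_inverse_le) (auto simp: y_def of_nat_diff)
    finally show "(real m + 1) / ((real i + 1) * (real (m - i) + 1))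
        \<le> inverse (real (Suc i)) + inverse (real (Suc (n - Suc i)))"
      by (simp add: x_def y_def add.commute)
  qed
  also have "\<dots> = harm n + harm n"
    unfolding sum.distrib harm_altdef
    using sum.nat_diff_reindex[of "\<lambda>i. inverse (real (Suc i))" n] by simp
  also have "\<dots> \<le> 2 * harm k"
    using harm_mono[OF assms(1), where ?'a = real] by simp
  finally show ?thesis .
qed

text \<open>Cauchy-Schwarz is applied in each degree \<open>m\<close> after inserting
  \<open>sqrt (m - i + 1)\<close>, the root of the Dirichlet weight of the coefficient taken from
  \<open>g i\<close>. One factor then adds up to the norms of the \<open>g i\<close>; the other,
  times the weight \<open>m + 1\<close>, is the sum in \<open>harm_convolution_le\<close>.\<close>

lemma dirichlet_row:
  assumes g: "\<And>i. i < k \<Longrightarrow> g i \<in> carr dirichlet_space"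
  shows "(hnorm dirichlet_space (\<lambda>z. \<Sum>i<k. of_real (1 / sqrt (real i + 1)) * (z ^ i * g i z)))\<^sup>2
           \<le> 2 * harm k * (\<Sum>i<k. (hnorm dirichlet_space (g i))\<^sup>2)"
proof -
  define c where "c i = 1 / sqrt (real i + 1)" for i
  let ?F = "\<lambda>z. \<Sum>i<k. of_real (c i) * (z ^ i * g i z)"
  have mem: "(\<lambda>z. of_real (c i) * (z ^ i * g i z)) \<in> carr dirichlet_space" if "i < k" for i
    using that by (intro dirichlet.scale_mem shift_mem_dirichlet g)
  then have F: "?F \<in> carr dirichlet_space"
    by (intro dirichlet.sum_mem) auto
  \<comment> \<open>The contribution of \<open>g i\<close> to degree \<open>m\<close> after the
    shift by \<open>i\<close>, but still with the weight of its original degree, so that summing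
    over \<open>m\<close> returns the norm of \<open>g i\<close>.\<close>
  define e where "e i m = (if m < i then 0 else (real (m - i) + 1) * (cmod (taylor_coeff (g i) (m - i)))\<^sup>2)" for i m
  have e_sums: "e i sums (hnorm dirichlet_space (g i))\<^sup>2" if "i < k" for i
  proof (subst sums_zero_iff_shift[of i, symmetric])
    show "(\<lambda>n. e i (n + i)) sums (hnorm dirichlet_space (g i))\<^sup>2"
      using g[OF that] by (auto simp: e_def hnorm_dirichlet carr_dirichlet)
  qed (simp add: e_def)
  have coeff: "taylor_coeff ?F m = (\<Sum>i<min (Suc m) k. of_real (c i) * taylor_coeff (g i) (m - i))" for m
  proof -
    have "taylor_coeff ?F m = (\<Sum>i<k. taylor_coeff (\<lambda>z. of_real (c i) * (z ^ i * g i z)) m)"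
    proof (rule taylor_coeff_unique[of 1])
      fix z :: complex assume "cmod z < 1"
      then show "(\<lambda>n. (\<Sum>i<k. taylor_coeff (\<lambda>z. of_real (c i) * (z ^ i * g i z)) n) * z ^ n) sums ?F z"
        unfolding sum_distrib_right by (intro sums_sum taylor_coeff_sums mem) auto
    qed simp
    also have "\<dots> = (\<Sum>i<k. if m < i then 0 else of_real (c i) * taylor_coeff (g i) (m - i))"
      by (intro sum.cong refl)
        (simp add: taylor_coeff_scale shift_mem_dirichlet g taylor_coeff_shift)
    also have "\<dots> = (\<Sum>i<min (Suc m) k. of_real (c i) * taylor_coeff (g i) (m - i))"
      by (intro sum.mono_neutral_cong_right) auto
    finally show ?thesis .
  qed
  have le: "(real m + 1) * (cmod (taylor_coeff ?F m))\<^sup>2 \<le> 2 * harm k * (\<Sum>i<k. e i m)" for m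
  proof -
    let ?n = "min (Suc m) k" and ?r = "\<lambda>i. sqrt (real (m - i) + 1)"
    let ?a = "\<lambda>i. cmod (taylor_coeff (g i) (m - i))"
    have "cmod (taylor_coeff ?F m) \<le> (\<Sum>i<?n. c i * ?a i)"
      unfolding coeff by (rule sum_norm_le) (simp add: norm_mult norm_divide c_def)
    also have "\<dots> = (\<Sum>i<?n. (c i / ?r i) * (?r i * ?a i))"
      by simp
    finally have "(cmod (taylor_coeff ?F m))\<^sup>2 \<le> (\<Sum>i<?n. (c i / ?r i) * (?r i * ?a i))\<^sup>2"
      by (intro power_mono) auto
    also have "\<dots> \<le> (\<Sum>i<?n. (c i / ?r i)\<^sup>2) * (\<Sum>i<?n. (?r i * ?a i)\<^sup>2)"
      by (rule Cauchy_Schwarz_ineq_sum)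
    also have "(\<Sum>i<?n. (?r i * ?a i)\<^sup>2) = (\<Sum>i<?n. e i m)"
      by (intro sum.cong refl) (auto simp: e_def power_mult_distrib)
    also have "\<dots> = (\<Sum>i<k. e i m)"
      by (intro sum.mono_neutral_left) (auto simp: e_def)
    finally have "(real m + 1) * (cmod (taylor_coeff ?F m))\<^sup>2
        \<le> (real m + 1) * ((\<Sum>i<?n. (c i / ?r i)\<^sup>2) * (\<Sum>i<k. e i m))"
      by (intro mult_left_mono) auto
    also have "\<dots> = (\<Sum>i<?n. (real m + 1) / ((real i + 1) * (real (m - i) + 1))) * (\<Sum>i<k. e i m)"
      by (simp add: c_def power_divide power_mult_distrib sum_distrib_left flip: mult.assoc)
    also have "\<dots> \<le> 2 * harm k * (\<Sum>i<k. e i m)"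
      by (intro mult_right_mono harm_convolution_le sum_nonneg) (auto simp: e_def)
    finally show ?thesis .
  qed
  have sums: "(\<lambda>m. 2 * harm k * (\<Sum>i<k. e i m)) sums (2 * harm k * (\<Sum>i<k. (hnorm dirichlet_space (g i))\<^sup>2))"
    by (intro sums_mult sums_sum e_sums) auto
  have "(hnorm dirichlet_space ?F)\<^sup>2 = (\<Sum>m. (real m + 1) * (cmod (taylor_coeff ?F m))\<^sup>2)"
    by (rule hnorm_dirichlet[OF F])
  also have "\<dots> \<le> (\<Sum>m. 2 * harm k * (\<Sum>i<k. e i m))"
    by (rule suminf_le[OF le]) (use F sums in \<open>auto simp: carr_dirichlet sums_iff\<close>)
  also have "\<dots> = 2 * harm k * (\<Sum>i<k. (hnorm dirichlet_space (g i))\<^sup>2)"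
    using sums by (simp add: sums_iff)
  finally show ?thesis by (simp add: c_def)
qed

text \<open>An elementary bound of growth below \<open>k\<close>; the induction compares
  \<open>1 / (k + 1)\<close> with the increment of \<open>2 sqrt k\<close>.\<close>

lemma harm_le_sqrt: "harm k \<le> 2 * sqrt (real k)"
proof (induction k)
  case (Suc k)
  have "(2 * sqrt (real k) * sqrt (real k + 1)) \<le> 2 * real k + 1"
    using sum_squares_bound[of "sqrt (real k)" "sqrt (real k + 1)"] by simp
  then have "1 \<le> 2 * (sqrt (real k + 1) - sqrt (real k)) * sqrt (real k + 1)"
    by (simp add: algebra_simps)
  also have "\<dots> \<le> 2 * (sqrt (real k + 1) - sqrt (real k)) * (real k + 1)"
    by (intro mult_left_mono) (auto intro: real_le_lsqrt simp: power2_eq_square algebra_simps)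
  finally have "inverse (real k + 1) \<le> 2 * (sqrt (real k + 1) - sqrt (real k))"
    by (simp add: field_simps)
  then show ?case
    using Suc by (simp add: harm_Suc add.commute)
qed (simp add: harm_def)

lemma no_cb_inverse_dirichlet:
  "\<not> has_cb_inverse (mult_os dirichlet_space) (mult_weak_product_os dirichlet_space) mult_inclusion"
proof
  let ?D = dirichlet_space
  assume "has_cb_inverse (mult_os ?D) (mult_weak_product_os ?D) mult_inclusion"
  then obtain C where C: "\<And>k \<phi> f. row_contraction ?D k \<phi> \<Longrightarrow> f \<in> carr ?D \<Longrightarrow> hnorm ?D f \<le> 1 \<Longrightarrow>
       (\<Sum>i<k. (hnorm ?D (\<lambda>x. \<phi> i x * f x))\<^sup>2) \<le> C"
    using dirichlet.cb_inverse_bounds_columns by blast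
  define one where "one z = (if z \<in> ball 0 1 then 1 else 0 :: complex)" for z :: complex
  have coeff_one: "taylor_coeff one n = (if n = 0 then 1 else 0)" for n
  proof (rule taylor_coeff_unique[of 1])
    fix z :: complex assume "cmod z < 1"
    then show "(\<lambda>n. (if n = 0 then 1 else 0) * z ^ n) sums one z"
      using sums_single[of 0 "\<lambda>n. z ^ n"] by (simp add: one_def if_distrib[of "\<lambda>x. x * _"] cong: if_cong)
  qed simp
  have "one holomorphic_on ball 0 1"
    by (rule holomorphic_transform[of "\<lambda>z. 1"]) (auto simp: one_def)
  moreover have "summable (\<lambda>n. (real n + 1) * (cmod (taylor_coeff one n))\<^sup>2)"
    by (rule summable_finite[of "{0}"]) (auto simp: coeff_one)
  ultimately have one: "one \<in> carr ?D"
    by (simp add: carr_dirichlet vanishes_off_def one_def)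
  have norm_shift: "(hnorm ?D (\<lambda>z. z ^ i * one z))\<^sup>2 = real i + 1" for i
  proof -
    have "(\<Sum>n. (real n + 1) * (cmod (taylor_coeff (\<lambda>z. z ^ i * one z) n))\<^sup>2)
        = (\<Sum>n\<in>{i}. (real n + 1) * (cmod (taylor_coeff (\<lambda>z. z ^ i * one z) n))\<^sup>2)"
      by (rule suminf_finite) (auto simp: taylor_coeff_shift[OF one] coeff_one)
    then show ?thesis
      by (simp add: hnorm_dirichlet shift_mem_dirichlet one taylor_coeff_shift[OF one] coeff_one)
  qed
  then have "(hnorm ?D one)\<^sup>2 = 1"
    using norm_shift[of 0] by simp
  then have norm_one: "hnorm ?D one = 1"
    using dirichlet.hnorm_nonneg[OF one] by (simp add: power2_eq_1_iff)
  have le: "real k \<le> C * (2 * harm k)" if k: "0 < k" for k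
  proof -
    define B where "B = 2 * (harm k :: real)"
    have B: "B > 0" using k by (simp add: B_def)
    \<comment> \<open>Dividing by \<open>sqrt B\<close> makes the row contractive. Since
      \<open>z^i\<close> has squared norm \<open>i + 1\<close>, each entry then sends
      \<open>one\<close> to a vector of squared norm \<open>1 / B\<close>.\<close>
    define c where "c i = 1 / sqrt (real i + 1) / sqrt B" for i
    define \<phi> where "\<phi> i = (\<lambda>z. if z \<in> ball 0 1 then of_real (c i) * z ^ i else 0 :: complex)" for i
    have \<phi>: "(\<lambda>z. \<phi> i z * f z) = (\<lambda>z. of_real (c i) * (z ^ i * f z))" if "f \<in> carr ?D" for i f
      using that by (auto simp: \<phi>_def carr_dirichlet vanishes_off_def)
    have "row_contraction ?D k \<phi>"
      unfolding row_contraction_def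
    proof (intro conjI allI impI ballI)
      show "vanishes_off (pts ?D) (\<phi> i)" for i
        by (simp add: vanishes_off_def \<phi>_def dirichlet_space_def)
      show "(\<lambda>x. \<phi> i x * f x) \<in> carr ?D" if "f \<in> carr ?D" for i f
        unfolding \<phi>[OF that] by (intro dirichlet.scale_mem shift_mem_dirichlet that)
      fix g :: "nat \<Rightarrow> complex \<Rightarrow> complex" assume g: "\<forall>i<k. g i \<in> carr ?D"
      define F where "F = (\<lambda>z. \<Sum>i<k. of_real (1 / sqrt (real i + 1)) * (z ^ i * g i z))"
      have F: "F \<in> carr ?D"
        unfolding F_def using g
        by (intro dirichlet.sum_mem dirichlet.scale_mem shift_mem_dirichlet) auto
      have "(\<Sum>i<k. \<phi> i z * g i z) = of_real (1 / sqrt B) * F z" for z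
      proof -
        have "(\<Sum>i<k. \<phi> i z * g i z) = (\<Sum>i<k. of_real (c i) * (z ^ i * g i z))"
          using g \<phi> by (intro sum.cong refl) (metis lessThan_iff)
        then show ?thesis
          by (simp add: F_def c_def sum_distrib_left mult_ac)
      qed
      then have "(hnorm ?D (\<lambda>z. \<Sum>i<k. \<phi> i z * g i z))\<^sup>2 = (hnorm ?D F)\<^sup>2 / B"
        using B by (simp only: dirichlet.hnorm_scale[OF F])
          (simp add: power_mult_distrib norm_divide power_divide)
      also have "\<dots> \<le> (\<Sum>i<k. (hnorm ?D (g i))\<^sup>2)"
        using dirichlet_row[of k g, folded F_def B_def] g B
        by (simp only: pos_divide_le_eq mult.commute[of _ B])
      finally show "(hnorm ?D (\<lambda>z. \<Sum>i<k. \<phi> i z * g i z))\<^sup>2 \<le> (\<Sum>i<k. (hnorm ?D (g i))\<^sup>2)" .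
    qed
    then have "(\<Sum>i<k. (hnorm ?D (\<lambda>z. \<phi> i z * one z))\<^sup>2) \<le> C"
      by (rule C[OF _ one]) (simp add: norm_one)
    moreover have "(hnorm ?D (\<lambda>z. \<phi> i z * one z))\<^sup>2 = 1 / B" for i
    proof -
      have "(hnorm ?D (\<lambda>z. \<phi> i z * one z))\<^sup>2 = (c i)\<^sup>2 * (real i + 1)"
        unfolding \<phi>[OF one] dirichlet.hnorm_scale[OF shift_mem_dirichlet[OF one]]
        by (simp add: power_mult_distrib norm_shift)
      also have "\<dots> = 1 / B"
        using B by (simp add: c_def power_divide power_mult_distrib)
      finally show ?thesis .
    qed
    ultimately have "real k / B \<le> C" by simp
    then show ?thesis
      using B by (simp add: B_def divide_le_eq)
  qed
  \<comment> \<open>The column bound and \<open>harm_le_sqrt\<close> give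
    \<open>k <= 4 * C * sqrt k\<close>, that is \<open>k <= (4 * C)^2\<close>; the choice of
    \<open>k\<close> excludes this.\<close>
  obtain k :: nat where k: "(4 * C)\<^sup>2 < real k" using reals_Archimedean2 by blast
  then have "0 < k" by (metis not_less of_nat_0 of_nat_0_less_iff zero_le_power2 less_le_trans le_less_trans)
  have "C \<ge> 0"
    using le[of 1] by (simp add: harm_def)
  have "real k \<le> C * (2 * (2 * sqrt (real k)))"
    using le[OF \<open>0 < k\<close>] harm_le_sqrt[of k] \<open>C \<ge> 0\<close> by (meson mult_left_mono order_trans zero_le_numeral)
  then have "sqrt (real k) * sqrt (real k) \<le> 4 * C * sqrt (real k)"
    by simp
  then have "sqrt (real k) \<le> 4 * C"
    using \<open>0 < k\<close> by (simp only: mult_le_cancel_right_pos real_sqrt_gt_0_iff of_nat_0_less_iff)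
  then have "real k \<le> (4 * C)\<^sup>2"
    using sqrt_le_D by blast
  then show False using k by simp
qed

theorem proposition4p5:
  shows "(\<forall>(d::enat) (H::(nat \<Rightarrow> complex) fspace).
            2 \<le> d \<longrightarrow> drury_arveson_space d H \<longrightarrow>
            \<not> has_cb_inverse (mult_os H) (mult_weak_product_os H) mult_inclusion) \<and>
         \<not> has_cb_inverse (mult_os dirichlet_space) (mult_weak_product_os dirichlet_space)
             mult_inclusion"
proof (intro conjI allI impI)
  fix d :: enat and H :: "(nat \<Rightarrow> complex) fspace"
  assume "2 \<le> d" "drury_arveson_space d H"
  then interpret drury_arveson d H
    by unfold_locales
  show "\<not> has_cb_inverse (mult_os H) (mult_weak_product_os H) mult_inclusion"
    by (rule no_cb_inverse)
qed (rule no_cb_inverse_dirichlet)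

end
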